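(* Let $\{\epsilon_{nk}\}$ be independent mean zero random variables with variances $\sigma_{nk}^2$ and third moments $\gamma_{nk}$ satisfying Assumption (E). Let $\mathfrak{a}$ be coefficients satisfying the decay condition (D). Then for $n',m'\ge0$ and $n\ge1$ $$\mathbb{E}\big(S_{n',m'}^{(n)}(\mathfrak{a},\mathbf{v}_n,\mathbf{w}_n)-\delta M_{m'+n'}^{(n)}(\mathfrak{a},\mathbf{v}_n,\mathbf{w}_n)\big)^2\stackrel{n,m',n'}{\ll}\|\mathbf{v}_n\|_{\ell_1}^2\|\mathbf{w}_n\|_{\ell_1}^2(n')^{1-\theta}.$$ Further, for coefficients $\mathfrak{b},\mathfrak{c}$ satisfying (D), and for $k\ge1$ and $n\ge1$, $$\mathbb{E}(\mathbf{D}_{nk}^{(1)}-\delta M_k^{(n)}(\mathfrak{b},\mathbf{v}_n,\mathbf{w}_n))^2\stackrel{n,k}{\ll}\|\mathbf{v}_n\|_{\ell_1}^2\|\mathbf{w}_n\|_{\ell_1}^2k^{1-\theta},$$ $$\mathbb{E}(\mathbf{D}_{nk}^{(2)}-\delta M_k^{(n)}(\mathfrak{c},\mathbf{v}_n,\mathbf{w}_n))^2\stackrel{n,k}{\ll}\|\mathbf{v}_n\|_{\ell_1}^2\|\mathbf{w}_n\|_{\ell_1}^2k^{1-\theta},$$ such that $$\mathbb{E}\|\mathbf{D}_{nk}-\delta\mathbf{M}_k^{(n)}\|_2^2\stackrel{n,k}{\ll}\|\mathbf{v}_n\|_{\ell_1}^2\|\mathbf{w}_n\|_{\ell_1}^2n^{1-\theta},$$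 where $\mathbf{D}_{nk}^{(1)}=S_{k,0}^{(n)}(\mathfrak{b},\mathbf{v}_n,\mathbf{w}_n)$, $\mathbf{D}_{nk}^{(2)}=S_{k,0}^{(n)}(\mathfrak{c},\mathbf{v}_n,\mathbf{w}_n)$, $\mathbf{D}_{nk}=(\mathbf{D}_{nk}^{(1)},\mathbf{D}_{nk}^{(2)})^\top$ and $\delta\mathbf{M}_k^{(n)}=(\delta M_k^{(n)}(\mathfrak{b},\mathbf{v}_n,\mathbf{w}_n),\delta M_k^{(n)}(\mathfrak{c},\mathbf{v}_n,\mathbf{w}_n))^\top$. The last three bounds also hold (with obvious modifications) if $\mathbf{D}_{nk}^{(1)}=S_{k,0}^{(n)}(\mathfrak{b},\mathbf{v}_n,\mathbf{w}_n)$ and $\mathbf{D}_{nk}^{(2)}=S_{k,0}^{(n)}(\mathfrak{c},\tilde{\mathbf{v}}_n,\tilde{\mathbf{w}}_n)$ for two pairs of weighting vectors, i.e. with $(\tilde{\mathbf{v}}_n,\tilde{\mathbf{w}}_n)$ replacing $(\mathbf{v}_n,\mathbf{w}_n)$ in the terms for the second component and its bound, where the bound in the last display is then given by $\max\{\|\mathbf{v}_n\|_{\ell_1}^2\|\mathbf{w}_n\|_{\ell_1}^2,\|\tilde{\mathbf{v}}_n\|_{\ell_1}^2\|\tilde{\mathbf{w}}_n\|_{\ell_1}^2\}n^{1-\theta}$.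
   Context: Notation: $a\stackrel{n,k}{\ll}b$ means there is a finite constant $C$, independent of the indices displayed over the symbol, with $a\le Cb$ for all values of these indices. $\mathbb{E}$ denotes expectation. Fix $\theta\in(0,1/2)$. The dimensions $d_n\in\mathbb{N}$ are arbitrary; all weighting vectors are in $\mathbb{R}^{d_n}$. Assumption (D): an array $\mathfrak{a}=\{a_{nj}^{(\nu)}: j\ge0, 1\le\nu\le d_n, n\ge1\}$ of reals satisfies (D) if $\sup_{n\ge1}\max_{1\le\nu\le d_n}|a_{nj}^{(\nu)}|\stackrel{j}{\ll}\max(1,j)^{-3/4-\theta/2}$. Assumption (E): $\{\epsilon_{nk}:k\in\mathbb{Z},n\in\mathbb{N}\}$ is an array of independent mean zero random variables with $\sup_{n}\sup_{k}\mathbb{E}|\epsilon_{nk}|^{4+\delta}<\infty$ (for some $\delta>0$), and with moment arrays $\sigma_{nk}^2=\mathbb{E}(\epsilon_{nk}^2)$, $\gamma_{nk}=\mathbb{E}(\epsilon_{nk}^3)$ satisfying $\frac1\ell\sum_{i=1}^\ell i|\sigma_{ni}^2-s_{n1}^2|=O(\ell^{-\beta_0})$ and $\frac1\ell\sum_{i=1}^\ell i|\gamma_{ni}-\gamma_n|=O(\ell^{-\beta_0})$ for some $\beta_0>1+\theta$ and sequences $\{s_{n1}\}$ and $\{\gamma_n\}$. For $\mathfrak{a}$ satisfying (D) and vectors $\mathbf{v}=(v_1,\dots,v_{d_n})^\top$, $\mathbf{w}=(w_1,\dots,w_{d_n})^\top$: $f_{0,j}^{(n)}(\mathfrak{a},\mathbf{v},\mathbf{w})=\sum_{\nu,\mu=1}^{d_n}v_\nu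 w_\mu a_{nj}^{(\nu)}a_{nj}^{(\mu)}$; $f_{\ell,j}^{(n)}(\mathfrak{a},\mathbf{v},\mathbf{w})=\sum_{\nu,\mu=1}^{d_n}v_\nu w_\mu[a_{nj}^{(\nu)}a_{n,j+\ell}^{(\mu)}+a_{nj}^{(\mu)}a_{n,j+\ell}^{(\nu)}]$ for $\ell\ge1$; $\tilde f_{\ell,i}^{(n)}=\sum_{j\ge i}f_{\ell,j}^{(n)}$. Martingales: $M_k^{(n)}(\mathfrak{a},\mathbf{v},\mathbf{w})=\tilde f_{0,0}^{(n)}(\mathfrak{a},\mathbf{v},\mathbf{w})\sum_{i=1}^k(\epsilon_{ni}^2-\sigma_{ni}^2)+\sum_{i=1}^k\epsilon_{ni}\sum_{\ell=1}^\infty\tilde f_{\ell,0}^{(n)}(\mathfrak{a},\mathbf{v},\mathbf{w})\epsilon_{n,i-\ell}$, $M_0^{(n)}=0$; $\delta M_{m'+n'}^{(n)}=M_{m'+n'}^{(n)}-M_{m'}^{(n)}$; $\delta M_k^{(n)}$ denotes the case $m'=0$, $n'=k$, i.e. $\delta M_k^{(n)}=M_k^{(n)}$. Partial sums: $S_{n',m'}^{(n)}(\mathfrak{a},\mathbf{v},\mathbf{w})=\sum_{i=m'+1}^{m'+n'}\big(Y_{ni}(\mathbf{v}^\top\mathfrak{a})Y_{ni}(\mathbf{w}^\top\mathfrak{a})-\mathbb{E}[Y_{ni}(\mathbf{v}^\top\mathfrak{a})Y_{ni}(\mathbf{w}^\top\mathfrak{a})]\big)$ with $Y_{ni}(\mathbf{z}^\top\mathfrak{a})=\sum_{j\ge0}\sum_{\nu=1}^{d_n}z_\nu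 a_{nj}^{(\nu)}\epsilon_{n,i-j}$.
   Formalization: The two bounds on the expected squared norm of the vector difference by n^{1-θ} are stated for 1 ≤ k ≤ n only, since for fixed n and k tending to infinity they fail (the left side can grow like k^{1-2θ}); the componentwise bounds hold for all n, k ≥ 1. *)

theory Defs
  imports "HOL-Probability.Probability" "HOL-Library.Landau_Symbols"
begin

text \<open>
  Conventions. The row index \<open>n\<close> of every array ranges over \<open>n \<ge> 1\<close>. A coefficient array \<open>a\<close> is
  used as \<open>a n j \<nu>\<close> with lag \<open>j \<ge> 0\<close> and coordinate \<open>1 \<le> \<nu> \<le> d n\<close>; the innovations are
  \<open>\<epsilon> n k \<omega>\<close> with \<open>k\<close> an integer. As the dimension \<open>d n\<close> varies with \<open>n\<close>, a vector of length
  \<open>d n\<close> is a function on \<open>nat\<close> of which only the values at \<open>1, \<dots>, d n\<close> are ever used.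
\<close>

definition decay_D :: "real \<Rightarrow> (nat \<Rightarrow> nat) \<Rightarrow> (nat \<Rightarrow> nat \<Rightarrow> nat \<Rightarrow> real) \<Rightarrow> bool" where
  "decay_D \<theta> d a \<longleftrightarrow>
     (\<exists>C. \<forall>j. \<forall>n\<ge>1. \<forall>\<nu>\<in>{1..d n}. \<bar>a n j \<nu>\<bar> \<le> C * max 1 (real j) powr (- (3/4) - \<theta>/2))"

definition var_arr :: "'a measure \<Rightarrow> (nat \<Rightarrow> int \<Rightarrow> 'a \<Rightarrow> real) \<Rightarrow> nat \<Rightarrow> int \<Rightarrow> real" where
  "var_arr M \<epsilon> n k = (\<integral>\<omega>. (\<epsilon> n k \<omega>)^2 \<partial>M)"

definition third_arr :: "'a measure \<Rightarrow> (nat \<Rightarrow> int \<Rightarrow> 'a \<Rightarrow> real) \<Rightarrow> nat \<Rightarrow> int \<Rightarrow> real" where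
  "third_arr M \<epsilon> n k = (\<integral>\<omega>. (\<epsilon> n k \<omega>)^3 \<partial>M)"

text \<open>
  The absolute moment of order \<open>4 + \<delta>\<close> is an extended nonnegative integral, so its finiteness is a
  genuine requirement and makes the Bochner integrals for the lower moments meaningful.
\<close>

definition assumption_E :: "'a measure \<Rightarrow> real \<Rightarrow> (nat \<Rightarrow> int \<Rightarrow> 'a \<Rightarrow> real) \<Rightarrow> bool" where
  "assumption_E M \<theta> \<epsilon> \<longleftrightarrow>
     prob_space.indep_vars M (\<lambda>_. borel) (\<lambda>(n, k). \<epsilon> n k) ({1..} \<times> UNIV) \<and>
     (\<forall>n\<ge>1. \<forall>k. (\<integral>\<omega>. \<epsilon> n k \<omega> \<partial>M) = 0) \<and>
     (\<exists>\<delta>>0. ((SUP n\<in>{1..}. (SUP k. (\<integral>\<^sup>+\<omega>. ennreal (\<bar>\<epsilon> n k \<omega>\<bar> powr (4 + \<delta>)) \<partial>M))) :: ennreal) < \<infinity>) \<and>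
     (\<exists>\<beta>\<^sub>0 > 1 + \<theta>. \<exists>(s :: nat \<Rightarrow> real) (g :: nat \<Rightarrow> real). \<forall>n\<ge>1.
        (\<lambda>l::nat. 1 / real l * (\<Sum>i=1..l. real i * \<bar>var_arr M \<epsilon> n (int i) - (s n)^2\<bar>))
          \<in> O(\<lambda>l. real l powr (- \<beta>\<^sub>0)) \<and>
        (\<lambda>l::nat. 1 / real l * (\<Sum>i=1..l. real i * \<bar>third_arr M \<epsilon> n (int i) - g n\<bar>))
          \<in> O(\<lambda>l. real l powr (- \<beta>\<^sub>0)))"

definition l1_norm :: "nat \<Rightarrow> (nat \<Rightarrow> real) \<Rightarrow> real" where
  "l1_norm m v = (\<Sum>\<nu>=1..m. \<bar>v \<nu>\<bar>)"

definition f_coef :: "(nat \<Rightarrow> nat) \<Rightarrow> nat \<Rightarrow> (nat \<Rightarrow> nat \<Rightarrow> nat \<Rightarrow> real) \<Rightarrow>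
    (nat \<Rightarrow> real) \<Rightarrow> (nat \<Rightarrow> real) \<Rightarrow> nat \<Rightarrow> nat \<Rightarrow> real" where
  "f_coef d n a v w l j =
     (if l = 0 then (\<Sum>\<nu>=1..d n. \<Sum>\<mu>=1..d n. v \<nu> * w \<mu> * (a n j \<nu> * a n j \<mu>))
      else (\<Sum>\<nu>=1..d n. \<Sum>\<mu>=1..d n.
              v \<nu> * w \<mu> * (a n j \<nu> * a n (j + l) \<mu> + a n j \<mu> * a n (j + l) \<nu>)))"

definition f_tail :: "(nat \<Rightarrow> nat) \<Rightarrow> nat \<Rightarrow> (nat \<Rightarrow> nat \<Rightarrow> nat \<Rightarrow> real) \<Rightarrow>
    (nat \<Rightarrow> real) \<Rightarrow> (nat \<Rightarrow> real) \<Rightarrow> nat \<Rightarrow> nat \<Rightarrow> real" where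
  "f_tail d n a v w l i = (\<Sum>j. f_coef d n a v w l (i + j))"

definition mart :: "'a measure \<Rightarrow> (nat \<Rightarrow> int \<Rightarrow> 'a \<Rightarrow> real) \<Rightarrow> (nat \<Rightarrow> nat) \<Rightarrow> nat \<Rightarrow>
    (nat \<Rightarrow> nat \<Rightarrow> nat \<Rightarrow> real) \<Rightarrow> (nat \<Rightarrow> real) \<Rightarrow> (nat \<Rightarrow> real) \<Rightarrow> nat \<Rightarrow> 'a \<Rightarrow> real" where
  "mart M \<epsilon> d n a v w k \<omega> =
     f_tail d n a v w 0 0 * (\<Sum>i=1..k. (\<epsilon> n (int i) \<omega>)^2 - var_arr M \<epsilon> n (int i)) +
     (\<Sum>i=1..k. \<epsilon> n (int i) \<omega> *
        (\<Sum>l. f_tail d n a v w (Suc l) 0 * \<epsilon> n (int i - int (Suc l)) \<omega>))"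

definition delta_mart :: "'a measure \<Rightarrow> (nat \<Rightarrow> int \<Rightarrow> 'a \<Rightarrow> real) \<Rightarrow> (nat \<Rightarrow> nat) \<Rightarrow> nat \<Rightarrow>
    (nat \<Rightarrow> nat \<Rightarrow> nat \<Rightarrow> real) \<Rightarrow> (nat \<Rightarrow> real) \<Rightarrow> (nat \<Rightarrow> real) \<Rightarrow> nat \<Rightarrow> nat \<Rightarrow> 'a \<Rightarrow> real" where
  "delta_mart M \<epsilon> d n a v w m' n' \<omega> = mart M \<epsilon> d n a v w (m' + n') \<omega> - mart M \<epsilon> d n a v w m' \<omega>"

definition lin_proc :: "(nat \<Rightarrow> int \<Rightarrow> 'a \<Rightarrow> real) \<Rightarrow> (nat \<Rightarrow> nat) \<Rightarrow> nat \<Rightarrow>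
    (nat \<Rightarrow> nat \<Rightarrow> nat \<Rightarrow> real) \<Rightarrow> (nat \<Rightarrow> real) \<Rightarrow> int \<Rightarrow> 'a \<Rightarrow> real" where
  "lin_proc \<epsilon> d n a z i \<omega> = (\<Sum>j. (\<Sum>\<nu>=1..d n. z \<nu> * a n j \<nu>) * \<epsilon> n (i - int j) \<omega>)"

definition part_sum :: "'a measure \<Rightarrow> (nat \<Rightarrow> int \<Rightarrow> 'a \<Rightarrow> real) \<Rightarrow> (nat \<Rightarrow> nat) \<Rightarrow> nat \<Rightarrow>
    (nat \<Rightarrow> nat \<Rightarrow> nat \<Rightarrow> real) \<Rightarrow> (nat \<Rightarrow> real) \<Rightarrow> (nat \<Rightarrow> real) \<Rightarrow> nat \<Rightarrow> nat \<Rightarrow> 'a \<Rightarrow> real" where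
  "part_sum M \<epsilon> d n a v w n' m' \<omega> =
     (\<Sum>i=m'+1..m'+n'.
        lin_proc \<epsilon> d n a v (int i) \<omega> * lin_proc \<epsilon> d n a w (int i) \<omega> -
        (\<integral>\<omega>'. lin_proc \<epsilon> d n a v (int i) \<omega>' * lin_proc \<epsilon> d n a w (int i) \<omega>' \<partial>M))"

text \<open>
  The bivariate objects carry a separate pair of weighting vectors for each component.
\<close>

definition D_vec :: "'a measure \<Rightarrow> (nat \<Rightarrow> int \<Rightarrow> 'a \<Rightarrow> real) \<Rightarrow> (nat \<Rightarrow> nat) \<Rightarrow> nat \<Rightarrow>
    (nat \<Rightarrow> nat \<Rightarrow> nat \<Rightarrow> real) \<Rightarrow> (nat \<Rightarrow> real) \<Rightarrow> (nat \<Rightarrow> real) \<Rightarrow>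
    (nat \<Rightarrow> nat \<Rightarrow> nat \<Rightarrow> real) \<Rightarrow> (nat \<Rightarrow> real) \<Rightarrow> (nat \<Rightarrow> real) \<Rightarrow> nat \<Rightarrow> 'a \<Rightarrow> real ^ 2" where
  "D_vec M \<epsilon> d n b v w c v' w' k \<omega> =
     vector [part_sum M \<epsilon> d n b v w k 0 \<omega>, part_sum M \<epsilon> d n c v' w' k 0 \<omega>]"

definition delta_mart_vec :: "'a measure \<Rightarrow> (nat \<Rightarrow> int \<Rightarrow> 'a \<Rightarrow> real) \<Rightarrow> (nat \<Rightarrow> nat) \<Rightarrow> nat \<Rightarrow>
    (nat \<Rightarrow> nat \<Rightarrow> nat \<Rightarrow> real) \<Rightarrow> (nat \<Rightarrow> real) \<Rightarrow> (nat \<Rightarrow> real) \<Rightarrow>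
    (nat \<Rightarrow> nat \<Rightarrow> nat \<Rightarrow> real) \<Rightarrow> (nat \<Rightarrow> real) \<Rightarrow> (nat \<Rightarrow> real) \<Rightarrow> nat \<Rightarrow> 'a \<Rightarrow> real ^ 2" where
  "delta_mart_vec M \<epsilon> d n b v w c v' w' k \<omega> =
     vector [delta_mart M \<epsilon> d n b v w 0 k \<omega>, delta_mart M \<epsilon> d n c v' w' 0 k \<omega>]"

text \<open>
  Expectations of squares are taken in \<open>[0, \<infinity>]\<close>; a finite bound on them therefore includes square
  integrability (a Bochner integral would be \<open>0\<close> for a non-integrable square).
\<close>

definition mean_sq :: "'a measure \<Rightarrow> ('a \<Rightarrow> 'b::real_normed_vector) \<Rightarrow> ennreal" where
  "mean_sq M X = (\<integral>\<^sup>+\<omega>. ennreal ((norm (X \<omega>))^2) \<partial>M)"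

end

theory Submission
  imports Defs
begin

text \<open>
  Fix a row of the arrays and write \<open>X p\<close> for its innovations, \<open>\<sigma>2 p\<close> for their variances and
  \<open>\<alpha> j\<close>, \<open>\<beta> j\<close> for the coefficients of the two linear processes, i.e. the sums over the coordinates
  of the entries of the array weighted by \<open>v\<close> and by \<open>w\<close>. Expanding the product of the two processes
  writes everything in terms of the variables
    \<open>\<eta> p q = X p * X q - (if p = q then \<sigma>2 p else 0)\<close> with \<open>q \<le> p\<close>,
  which are orthogonal and bounded in \<open>L\<^sup>2\<close>. With \<open>f l j = cross_coef \<alpha> \<beta> l j\<close>, the
  partial sum over the window \<open>m < i \<le> m + n\<close> has at \<open>\<eta> p q\<close> the sum of the \<open>f (p - q) (i - p)\<close>
  over all \<open>i \<ge> p\<close> in the window, while the martingale increment has there the full series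
  \<open>\<Sum>j. f (p - q) j\<close> if \<open>p\<close> lies in the window, and nothing otherwise. The difference, called
  \<open>residual_coef\<close>, is therefore
    minus the tail \<open>\<Sum>j\<ge>r. f (p - q) j\<close> with \<open>r = m + n + 1 - p\<close>, for \<open>p\<close> in the window;
    the block \<open>\<Sum>r\<le>j<r+n. f (p - q) j\<close> with \<open>r = m + 1 - p\<close>, for \<open>p\<close> before the window.
  By orthogonality (\<open>quadratic_form_square\<close>) the mean square of the difference is at most a constant
  times the sum of the squares of these coefficients, and what remains is a question about sums of
  powers.

  The decay exponent \<open>3/4 + \<theta>/2\<close> is used in the form
    \<open>decay \<theta> j * decay \<theta> (j + l) \<le> j powr (-1 - \<theta>/2) * (r + l) powr (-1/2 - \<theta>/2)\<close> for \<open>1 \<le> r \<le> j\<close>.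
  It is summable in \<open>j\<close>, so a tail or block beginning at \<open>r\<close> is of order \<open>(r + l) powr (-1/2 - \<theta>/2)\<close>.
  The squares of that sum over \<open>l\<close> to order \<open>r powr (-\<theta>)\<close>, and over \<open>1 \<le> r \<le> n\<close> to order
  \<open>n powr (1 - \<theta>)\<close>. Blocks with \<open>r > n\<close> gain a factor \<open>n * r powr (-1 - \<theta>/2)\<close> and contribute
  only \<open>n powr (1 - 2 * \<theta>)\<close>. This is \<open>residual_energy_le\<close>.

  All these expressions involve infinite series of innovations, defined pointwise. They are reached
  as limits of finite quadratic forms by discarding the innovations with index below \<open>-J\<close>. Since this
  cuts the innovations and leaves every coefficient as it is, the cut residual is exactly the
  form with coefficients \<open>residual_coef\<close> restricted to \<open>p, q \<ge> -J\<close>, so that the energy bound is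
  uniform in \<open>J\<close> and Fatou's lemma finishes the proof (\<open>mean_square_residual\<close>). Two facts justify
  the passage to the limit: series of independent centred variables with square summable coefficients
  converge almost surely (\<open>AE_summable_innovations\<close>, from Kolmogorov's maximal inequality), and the
  centring constants converge (\<open>expectation_product_of_linear_forms\<close>, from convergence in \<open>L\<^sup>2\<close>).
\<close>

section \<open>Independent innovations\<close>

text \<open>
  One row of the innovation array. A single constant bounds the second and the fourth moments, so that
  all bounds proved in the locale are uniform over the rows sharing this constant.
\<close>
locale indep_innovations = prob_space M for M :: "'a measure" +
  fixes X :: "int \<Rightarrow> 'a \<Rightarrow> real" and K :: real
  assumes indep: "indep_vars (\<lambda>_. borel) X UNIV"
    and mean_zero: "expectation (X k) = 0"
    and integrable_fourth: "integrable M (\<lambda>\<omega>. X k \<omega> ^ 4)"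
    and fourth_le: "expectation (\<lambda>\<omega>. X k \<omega> ^ 4) \<le> K"
    and second_le: "expectation (\<lambda>\<omega>. X k \<omega> ^ 2) \<le> K"
    and K_ge_1: "1 \<le> K"
begin

lemma X_measurable [measurable]: "X k \<in> borel_measurable M"
  using indep by (simp add: indep_vars_def)

lemma integrable_square: "integrable M (\<lambda>\<omega>. X k \<omega> ^ 2)"
  by (rule square_integrable_imp_integrable) (auto simp: integrable_fourth simp flip: power_mult)

lemma integrable_X: "integrable M (X k)"
  by (rule square_integrable_imp_integrable) (auto simp: integrable_square)

abbreviation \<sigma>2 :: "int \<Rightarrow> real" where "\<sigma>2 k \<equiv> expectation (\<lambda>\<omega>. X k \<omega> ^ 2)"

lemma indep_of_others:
  fixes f :: "(int \<Rightarrow> real) \<Rightarrow> real" and g :: "real \<Rightarrow> real"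
  assumes "x \<notin> P"
    and f: "f \<in> borel_measurable (PiM P (\<lambda>_. borel))"
    and g: "g \<in> borel_measurable borel"
    and intf: "integrable M (\<lambda>\<omega>. f (\<lambda>p\<in>P. X p \<omega>))"
    and intg: "integrable M (\<lambda>\<omega>. g (X x \<omega>))"
  shows "integrable M (\<lambda>\<omega>. f (\<lambda>p\<in>P. X p \<omega>) * g (X x \<omega>))"
    and "expectation (\<lambda>\<omega>. f (\<lambda>p\<in>P. X p \<omega>) * g (X x \<omega>)) =
         expectation (\<lambda>\<omega>. f (\<lambda>p\<in>P. X p \<omega>)) * expectation (\<lambda>\<omega>. g (X x \<omega>))"
proof -
  have "indep_var (PiM P (\<lambda>_. borel)) (\<lambda>\<omega>. \<lambda>p\<in>P. X p \<omega>)
                  (PiM {x} (\<lambda>_. borel)) (\<lambda>\<omega>. \<lambda>p\<in>{x}. X p \<omega>)"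
    using assms(1) by (intro indep_var_restrict[OF indep]) auto
  moreover have "(\<lambda>y. g (y x)) \<in> borel_measurable (PiM {x} (\<lambda>_. borel))"
    by (rule measurable_compose[OF _ g]) measurable
  ultimately have "indep_var borel (f \<circ> (\<lambda>\<omega>. \<lambda>p\<in>P. X p \<omega>)) borel ((\<lambda>y. g (y x)) \<circ> (\<lambda>\<omega>. \<lambda>p\<in>{x}. X p \<omega>))"
    using f by (intro indep_var_compose)
  then have *: "indep_var borel (\<lambda>\<omega>. f (\<lambda>p\<in>P. X p \<omega>)) borel (\<lambda>\<omega>. g (X x \<omega>))"
    by (simp add: o_def)
  show "integrable M (\<lambda>\<omega>. f (\<lambda>p\<in>P. X p \<omega>) * g (X x \<omega>))"
    by (rule indep_var_integrable[OF * intf intg])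
  show "expectation (\<lambda>\<omega>. f (\<lambda>p\<in>P. X p \<omega>) * g (X x \<omega>)) =
         expectation (\<lambda>\<omega>. f (\<lambda>p\<in>P. X p \<omega>)) * expectation (\<lambda>\<omega>. g (X x \<omega>))"
    by (rule indep_var_lebesgue_integral[OF * intf intg])
qed

text \<open>
  Measurability with respect to the sigma algebra of the coordinates in \<open>P\<close>, stated through the
  factorising function because that is the form in which independence of disjoint families of
  coordinates can be used.
\<close>
definition determined_by :: "int set \<Rightarrow> ('a \<Rightarrow> real) \<Rightarrow> bool" where
  "determined_by P Z \<longleftrightarrow> (\<exists>f\<in>borel_measurable (PiM P (\<lambda>_. borel)). \<forall>\<omega>\<in>space M. Z \<omega> = f (\<lambda>p\<in>P. X p \<omega>))"

lemma determined_by_mult: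
  assumes "determined_by P Z" and "x \<notin> P" and g: "g \<in> borel_measurable borel"
    and Z: "integrable M Z" and intg: "integrable M (\<lambda>\<omega>. g (X x \<omega>))"
  shows "integrable M (\<lambda>\<omega>. Z \<omega> * g (X x \<omega>))"
    and "expectation (\<lambda>\<omega>. Z \<omega> * g (X x \<omega>)) = expectation Z * expectation (\<lambda>\<omega>. g (X x \<omega>))"
proof -
  obtain f where f: "f \<in> borel_measurable (PiM P (\<lambda>_. borel))"
    and Zf: "\<And>\<omega>. \<omega> \<in> space M \<Longrightarrow> Z \<omega> = f (\<lambda>p\<in>P. X p \<omega>)"
    using assms(1) by (auto simp: determined_by_def)
  have Zf': "integrable M Z \<longleftrightarrow> integrable M (\<lambda>\<omega>. f (\<lambda>p\<in>P. X p \<omega>))"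
    "expectation Z = expectation (\<lambda>\<omega>. f (\<lambda>p\<in>P. X p \<omega>))"
    "integrable M (\<lambda>\<omega>. Z \<omega> * g (X x \<omega>)) \<longleftrightarrow> integrable M (\<lambda>\<omega>. f (\<lambda>p\<in>P. X p \<omega>) * g (X x \<omega>))"
    "expectation (\<lambda>\<omega>. Z \<omega> * g (X x \<omega>)) = expectation (\<lambda>\<omega>. f (\<lambda>p\<in>P. X p \<omega>) * g (X x \<omega>))"
    by (intro Bochner_Integration.integrable_cong Bochner_Integration.integral_cong refl; simp add: Zf)+
  note * = indep_of_others[OF \<open>x \<notin> P\<close> f g Z[unfolded Zf'(1)] intg]
  show "integrable M (\<lambda>\<omega>. Z \<omega> * g (X x \<omega>))"
    unfolding Zf' by (rule *(1))
  show "expectation (\<lambda>\<omega>. Z \<omega> * g (X x \<omega>)) = expectation Z * expectation (\<lambda>\<omega>. g (X x \<omega>))"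
    unfolding Zf' by (rule *(2))
qed

lemma determined_by_const: "determined_by P (\<lambda>_. c)"
  unfolding determined_by_def by (intro bexI[of _ "\<lambda>_. c"]) auto

lemma determined_by_coord: "p \<in> P \<Longrightarrow> determined_by P (X p)"
  unfolding determined_by_def by (intro bexI[of _ "\<lambda>y. y p"]) auto

lemma determined_by_comp2:
  assumes "determined_by P Y" "determined_by P Z" and h: "(\<lambda>(a, b). h a b) \<in> borel_measurable (borel \<Otimes>\<^sub>M borel)"
  shows "determined_by P (\<lambda>\<omega>. h (Y \<omega>) (Z \<omega>) :: real)"
proof -
  obtain f where f [measurable]: "f \<in> borel_measurable (PiM P (\<lambda>_. borel))"
    and Zf: "\<And>\<omega>. \<omega> \<in> space M \<Longrightarrow> Y \<omega> = f (\<lambda>p\<in>P. X p \<omega>)"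
    using assms(1) by (auto simp: determined_by_def)
  obtain g where g [measurable]: "g \<in> borel_measurable (PiM P (\<lambda>_. borel))"
    and Zg: "\<And>\<omega>. \<omega> \<in> space M \<Longrightarrow> Z \<omega> = g (\<lambda>p\<in>P. X p \<omega>)"
    using assms(2) by (auto simp: determined_by_def)
  have "(\<lambda>y. (f y, g y)) \<in> PiM P (\<lambda>_. borel) \<rightarrow>\<^sub>M borel \<Otimes>\<^sub>M borel" by measurable
  from measurable_compose[OF this h] have "(\<lambda>y. h (f y) (g y)) \<in> borel_measurable (PiM P (\<lambda>_. borel))" by simp
  then show ?thesis
    unfolding determined_by_def by (intro bexI[of _ "\<lambda>y. h (f y) (g y)"]) (auto simp: Zf Zg)
qed

lemma determined_by_add: "determined_by P Y \<Longrightarrow> determined_by P Z \<Longrightarrow> determined_by P (\<lambda>\<omega>. Y \<omega> + Z \<omega>)"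
  by (rule determined_by_comp2) measurable

lemma determined_by_times: "determined_by P Y \<Longrightarrow> determined_by P Z \<Longrightarrow> determined_by P (\<lambda>\<omega>. Y \<omega> * Z \<omega>)"
  by (rule determined_by_comp2) measurable

lemma determined_by_sum: "(\<And>i. i \<in> I \<Longrightarrow> determined_by P (Y i)) \<Longrightarrow> determined_by P (\<lambda>\<omega>. \<Sum>i\<in>I. Y i \<omega>)"
  by (induction I rule: infinite_finite_induct) (auto intro: determined_by_const determined_by_add)

lemma determined_by_mono:
  assumes "determined_by P Z" "P \<subseteq> Q" shows "determined_by Q Z"
proof -
  obtain f where f [measurable]: "f \<in> borel_measurable (PiM P (\<lambda>_. borel))"
    and Zf: "\<And>\<omega>. \<omega> \<in> space M \<Longrightarrow> Z \<omega> = f (\<lambda>p\<in>P. X p \<omega>)"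
    using assms(1) by (auto simp: determined_by_def)
  have "(\<lambda>y. f (restrict y P)) \<in> borel_measurable (PiM Q (\<lambda>_. borel))"
    by (rule measurable_compose[OF measurable_restrict_subset[OF assms(2)] f])
  moreover have "restrict (\<lambda>p\<in>Q. y p) P = restrict y P" for y :: "int \<Rightarrow> real"
    using assms(2) by (auto simp: restrict_def fun_eq_iff)
  ultimately show ?thesis
    unfolding determined_by_def by (intro bexI[of _ "\<lambda>y. f (restrict y P)"]) (auto simp: Zf)
qed

lemma determined_by_measurable: assumes "determined_by P Z" shows "Z \<in> borel_measurable M"
proof -
  obtain f where f [measurable]: "f \<in> borel_measurable (PiM P (\<lambda>_. borel))"
    and Zf: "\<And>\<omega>. \<omega> \<in> space M \<Longrightarrow> Z \<omega> = f (\<lambda>p\<in>P. X p \<omega>)"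
    using assms(1) by (auto simp: determined_by_def)
  have "(\<lambda>\<omega>. f (\<lambda>p\<in>P. X p \<omega>)) \<in> borel_measurable M" by measurable
  then show ?thesis using Zf by (simp cong: measurable_cong)
qed

end

section \<open>Second moments of linear and quadratic forms\<close>

lemma integrable_prod_of_squares:
  fixes f g :: "'a \<Rightarrow> real"
  assumes [measurable]: "f \<in> borel_measurable M" "g \<in> borel_measurable M"
    and "integrable M (\<lambda>x. f x ^ 2)" "integrable M (\<lambda>x. g x ^ 2)"
  shows "integrable M (\<lambda>x. f x * g x)"
proof (rule Bochner_Integration.integrable_bound)
  show "integrable M (\<lambda>x. f x ^ 2 + g x ^ 2)" using assms by simp
  have "2 * \<bar>a * b\<bar> \<le> a\<^sup>2 + b\<^sup>2" for a b :: real
    using sum_squares_bound[of "\<bar>a\<bar>" "\<bar>b\<bar>"] by (simp add: abs_mult)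
  then have "\<bar>a * b\<bar> \<le> a\<^sup>2 + b\<^sup>2" for a b :: real
    by (metis abs_ge_zero mult_2 le_add_same_cancel1 order_trans)
  then show "AE x in M. norm (f x * g x) \<le> norm (f x ^ 2 + g x ^ 2)"
    by simp
qed measurable

context indep_innovations
begin

text \<open>
  A martingale step: the cross term \<open>2 * Y * Z * X x\<close> has mean zero because \<open>X x\<close> is centred and
  independent of the coordinates that determine \<open>Y\<close> and \<open>Z\<close>. Linear forms and the stopped sums below
  are built by iterating this step.
\<close>
lemma square_add_innovation:
  assumes Y: "determined_by P Y" and Z: "determined_by P Z" and x: "x \<notin> P"
    and Y2: "integrable M (\<lambda>\<omega>. Y \<omega> ^ 2)" and Z2: "integrable M (\<lambda>\<omega>. Z \<omega> ^ 2)"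
  shows "integrable M (\<lambda>\<omega>. (Y \<omega> + Z \<omega> * X x \<omega>)^2)"
    and "expectation (\<lambda>\<omega>. (Y \<omega> + Z \<omega> * X x \<omega>)^2) =
         expectation (\<lambda>\<omega>. Y \<omega> ^ 2) + expectation (\<lambda>\<omega>. Z \<omega> ^ 2) * \<sigma>2 x"
proof -
  note [measurable] = determined_by_measurable[OF Y] determined_by_measurable[OF Z]
  have YZ: "integrable M (\<lambda>\<omega>. 2 * Y \<omega> * Z \<omega>)"
    using integrable_prod_of_squares[of Y M Z] Y2 Z2 by (simp add: mult.assoc)
  have pYZ: "determined_by P (\<lambda>\<omega>. 2 * Y \<omega> * Z \<omega>)" by (intro determined_by_times determined_by_const Y Z)
  note 1 = determined_by_mult[OF pYZ x, of "\<lambda>u. u", OF _ YZ integrable_X]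
  have pZZ: "determined_by P (\<lambda>\<omega>. Z \<omega> ^ 2)" unfolding power2_eq_square by (intro determined_by_times Z)
  note 2 = determined_by_mult[OF pZZ x, of "\<lambda>u. u ^ 2", OF _ Z2 integrable_square]
  have eq: "(\<lambda>\<omega>. (Y \<omega> + Z \<omega> * X x \<omega>)^2) =
      (\<lambda>\<omega>. Y \<omega> ^ 2 + (2 * Y \<omega> * Z \<omega> * X x \<omega> + Z \<omega> ^ 2 * X x \<omega> ^ 2))"
    by (rule ext) (simp add: power2_eq_square algebra_simps)
  show "integrable M (\<lambda>\<omega>. (Y \<omega> + Z \<omega> * X x \<omega>)^2)"
    unfolding eq using 1 2 Y2 by simp
  show "expectation (\<lambda>\<omega>. (Y \<omega> + Z \<omega> * X x \<omega>)^2) =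
         expectation (\<lambda>\<omega>. Y \<omega> ^ 2) + expectation (\<lambda>\<omega>. Z \<omega> ^ 2) * \<sigma>2 x"
    unfolding eq using 1 2 Y2 by (simp add: mean_zero)
qed

lemma linear_form_square:
  assumes "finite P"
  shows "determined_by P (\<lambda>\<omega>. \<Sum>p\<in>P. c p * X p \<omega>)"
    and "integrable M (\<lambda>\<omega>. (\<Sum>p\<in>P. c p * X p \<omega>)^2)"
    and "expectation (\<lambda>\<omega>. (\<Sum>p\<in>P. c p * X p \<omega>)^2) = (\<Sum>p\<in>P. c p ^ 2 * \<sigma>2 p)"
proof -
  show det: "determined_by P (\<lambda>\<omega>. \<Sum>p\<in>P. c p * X p \<omega>)" for P
    by (intro determined_by_sum determined_by_times determined_by_const determined_by_coord)
  have "integrable M (\<lambda>\<omega>. (\<Sum>p\<in>P. c p * X p \<omega>)^2) \<and>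
     expectation (\<lambda>\<omega>. (\<Sum>p\<in>P. c p * X p \<omega>)^2) = (\<Sum>p\<in>P. c p ^ 2 * \<sigma>2 p)"
    using assms
  proof induction
    case (insert x P)
    from square_add_innovation[OF det[of P] determined_by_const[of P "c x"] \<open>x \<notin> P\<close>] insert
    show ?case by (simp add: prob_space algebra_simps)
  qed simp
  then show "integrable M (\<lambda>\<omega>. (\<Sum>p\<in>P. c p * X p \<omega>)^2)"
    "expectation (\<lambda>\<omega>. (\<Sum>p\<in>P. c p * X p \<omega>)^2) = (\<Sum>p\<in>P. c p ^ 2 * \<sigma>2 p)" by auto
qed

lemma expectation_X_mult: "expectation (\<lambda>\<omega>. X p \<omega> * X q \<omega>) = (if p = q then \<sigma>2 p else 0)"
proof (cases "p = q")
  case False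
  then show ?thesis
    using determined_by_mult(2)[OF determined_by_coord[of p "{p}"], of q "\<lambda>u. u"] by (simp add: integrable_X mean_zero)
qed (simp add: power2_eq_square)

lemma integrable_X_mult: "integrable M (\<lambda>\<omega>. X p \<omega> * X q \<omega>)"
  by (rule integrable_prod_of_squares) (auto simp: integrable_square)

text \<open>
  Adding an index \<open>b\<close> larger than all previous ones adds to the form a multiple \<open>h (X b)\<close> of the
  centred square of \<open>X b\<close> and a product \<open>L * X b\<close>, where \<open>L\<close> is linear in the previous variables.
  All products with the old form, and the product of \<open>L * X b\<close> with \<open>h (X b)\<close>, have mean zero
  (for the last one because \<open>L\<close> is centred), so the mean squares add up.
\<close>
lemma quadratic_form_square:
  fixes c :: "int \<Rightarrow> int \<Rightarrow> real"
  assumes "finite P"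
  defines "Q \<equiv> \<lambda>P \<omega>. \<Sum>p\<in>P. c p p * (X p \<omega> ^ 2 - \<sigma>2 p) + (\<Sum>q\<in>{q\<in>P. q < p}. c p q * X q \<omega>) * X p \<omega>"
  shows "integrable M (\<lambda>\<omega>. (Q P \<omega>)^2)"
    and "expectation (\<lambda>\<omega>. (Q P \<omega>)^2) \<le> 2 * K^2 * (\<Sum>p\<in>P. \<Sum>q\<in>{q\<in>P. q \<le> p}. (c p q)^2)"
proof -
  have detQ: "determined_by P (Q P)" for P
    unfolding Q_def power2_eq_square diff_conv_add_uminus
    by (intro determined_by_sum determined_by_add determined_by_times determined_by_const determined_by_coord) auto
  have "integrable M (\<lambda>\<omega>. (Q P \<omega>)^2) \<and>
    expectation (\<lambda>\<omega>. (Q P \<omega>)^2) \<le> 2 * K^2 * (\<Sum>p\<in>P. \<Sum>q\<in>{q\<in>P. q \<le> p}. (c p q)^2)"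
    using assms(1)
  proof (induction rule: finite_linorder_max_induct)
    case empty
    then show ?case by (simp add: Q_def)
  next
    case (insert b A)
    have b: "b \<notin> A" using insert by auto
    define L where "L = (\<lambda>\<omega>. \<Sum>q\<in>A. c b q * X q \<omega>)"
    define h where "h = (\<lambda>u. c b b * (u ^ 2 - \<sigma>2 b))"
    have lin: "determined_by A L" "integrable M (\<lambda>\<omega>. L \<omega> ^ 2)"
        "expectation (\<lambda>\<omega>. L \<omega> ^ 2) = (\<Sum>q\<in>A. c b q ^ 2 * \<sigma>2 q)"
      unfolding L_def by (rule linear_form_square[OF \<open>finite A\<close>])+
    have sub: "{q. (q = b \<or> q \<in> A) \<and> q < p} = {q\<in>A. q < p}"
         "{q. (q = b \<or> q \<in> A) \<and> q \<le> p} = {q\<in>A. q \<le> p}" if "p \<in> A" for p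
      using that insert by (auto)
    have sub2: "{q. (q = b \<or> q \<in> A) \<and> q < b} = A" "{q. (q = b \<or> q \<in> A) \<and> q \<le> b} = insert b A"
      using insert by (auto)
    have Q_eq: "Q (insert b A) \<omega> = (Q A \<omega> + L \<omega> * X b \<omega>) + h (X b \<omega>)" for \<omega>
      using insert b unfolding Q_def L_def h_def
      by (simp add: sub sub2 cong: sum.cong)
    have hm [measurable]: "h \<in> borel_measurable borel"
      unfolding h_def by measurable
    have h1: "integrable M (\<lambda>\<omega>. h (X b \<omega>))" "expectation (\<lambda>\<omega>. h (X b \<omega>)) = 0"
      unfolding h_def by (simp_all add: integrable_square prob_space)
    have e4: "(\<lambda>\<omega>. h (X b \<omega>) ^ 2) = (\<lambda>\<omega>. (c b b)^2 * (X b \<omega> ^ 4 - 2 * \<sigma>2 b * X b \<omega> ^ 2 + (\<sigma>2 b)^2))"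
      unfolding h_def by (rule ext) (simp add: power2_eq_square power4_eq_xxxx algebra_simps)
    have h2: "integrable M (\<lambda>\<omega>. h (X b \<omega>) ^ 2)"
      unfolding e4 by (simp add: integrable_square integrable_fourth)
    have "expectation (\<lambda>\<omega>. h (X b \<omega>) ^ 2) = (c b b)^2 * (expectation (\<lambda>\<omega>. X b \<omega> ^ 4) - (\<sigma>2 b)^2)"
      unfolding e4
      by (simp add: integrable_square integrable_fourth prob_space) (simp add: power2_eq_square[of "\<sigma>2 b"])
    also have "\<dots> \<le> (c b b)^2 * K"
      using fourth_le[of b] by (intro mult_left_mono) (auto intro: order_trans[rotated])
    finally have h2e: "expectation (\<lambda>\<omega>. h (X b \<omega>) ^ 2) \<le> (c b b)^2 * K" .
    note QL = square_add_innovation[OF detQ lin(1) b conjunct1[OF insert(3)] lin(2)]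
    note [measurable] = determined_by_measurable[OF detQ[of A]] determined_by_measurable[OF lin(1)]
    have int2: "integrable M (\<lambda>\<omega>. (Q (insert b A) \<omega>)^2)"
    proof (rule Bochner_Integration.integrable_bound)
      show "integrable M (\<lambda>\<omega>. 2 * (Q A \<omega> + L \<omega> * X b \<omega>)^2 + 2 * h (X b \<omega>) ^ 2)"
        using QL(1) h2 by simp
      show "AE \<omega> in M. norm ((Q (insert b A) \<omega>)^2) \<le> norm (2 * (Q A \<omega> + L \<omega> * X b \<omega>)^2 + 2 * h (X b \<omega>) ^ 2)"
      proof (rule AE_I2)
        fix \<omega>
        have "(s + t)^2 \<le> 2 * s^2 + 2 * t^2" for s t :: real
          using zero_le_power2[of "s - t"] by (simp add: power2_eq_square algebra_simps)
        then show "norm ((Q (insert b A) \<omega>)^2) \<le> norm (2 * (Q A \<omega> + L \<omega> * X b \<omega>)^2 + 2 * h (X b \<omega>) ^ 2)"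
          unfolding Q_eq by simp
      qed
      show "(\<lambda>\<omega>. (Q (insert b A) \<omega>)^2) \<in> borel_measurable M"
        unfolding Q_eq by measurable
    qed
    have intQ: "integrable M (Q A)"
      by (rule square_integrable_imp_integrable) (use insert in auto)
    have intL: "integrable M L"
      by (rule square_integrable_imp_integrable) (use lin in auto)
    have c1: "integrable M (\<lambda>\<omega>. Q A \<omega> * h (X b \<omega>))" "expectation (\<lambda>\<omega>. Q A \<omega> * h (X b \<omega>)) = 0"
      using determined_by_mult[OF detQ b hm intQ h1(1)] h1(2) by auto
    have m3: "integrable M (\<lambda>\<omega>. X b \<omega> * h (X b \<omega>))"
      by (rule integrable_prod_of_squares) (auto simp: integrable_square h2)
    have [simp]: "expectation L = 0"
      unfolding L_def using integrable_X by (simp add: mean_zero)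
    have c2: "integrable M (\<lambda>\<omega>. L \<omega> * (X b \<omega> * h (X b \<omega>)))" "expectation (\<lambda>\<omega>. L \<omega> * (X b \<omega> * h (X b \<omega>))) = 0"
      using determined_by_mult[OF lin(1) b, of "\<lambda>u. u * h u", OF _ intL m3] by auto
    have expand: "(\<lambda>\<omega>. (Q (insert b A) \<omega>)^2) = (\<lambda>\<omega>. (Q A \<omega> + L \<omega> * X b \<omega>)^2 + h (X b \<omega>)^2
        + 2 * (Q A \<omega> * h (X b \<omega>)) + 2 * (L \<omega> * (X b \<omega> * h (X b \<omega>))))"
      unfolding Q_eq by (rule ext) (simp add: power2_eq_square algebra_simps)
    \<comment> \<open>The mixed terms containing \<open>h (X b)\<close> have mean zero by c1 and c2, the one of \<open>Q A\<close> and
        \<open>L * X b\<close> is already absent from QL.\<close>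
    have "expectation (\<lambda>\<omega>. (Q (insert b A) \<omega>)^2) =
       expectation (\<lambda>\<omega>. Q A \<omega> ^ 2) + expectation (\<lambda>\<omega>. L \<omega> ^ 2) * \<sigma>2 b + expectation (\<lambda>\<omega>. h (X b \<omega>)^2)"
      unfolding expand using QL h2 c1 c2 by simp
    also have "\<dots> \<le> 2 * K^2 * (\<Sum>p\<in>A. \<Sum>q\<in>{q\<in>A. q \<le> p}. (c p q)^2) + (\<Sum>q\<in>A. (c b q)^2 * K) * K + (c b b)^2 * K"
      using insert(3) h2e K_ge_1 unfolding lin(3)
      by (intro add_mono mult_mono sum_mono mult_left_mono second_le sum_nonneg) auto
    also have "\<dots> \<le> 2 * K^2 * (\<Sum>p\<in>A. \<Sum>q\<in>{q\<in>A. q \<le> p}. (c p q)^2) + 2 * K^2 * (\<Sum>q\<in>A. (c b q)^2) + 2 * K^2 * (c b b)^2"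
    proof -
      have "(\<Sum>q\<in>A. (c b q)^2 * K) * K = K^2 * (\<Sum>q\<in>A. (c b q)^2)"
        by (simp add: power2_eq_square sum_distrib_left sum_distrib_right mult_ac)
      moreover have "K^2 * (\<Sum>q\<in>A. (c b q)^2) \<ge> 0" by (simp add: sum_nonneg)
      moreover have "(c b b)^2 * K \<le> (c b b)^2 * (2 * K^2)"
        using K_ge_1 by (intro mult_left_mono) (auto simp: power2_eq_square mult_le_cancel_right1 intro: order_trans[of _ "K*K"])
      ultimately show ?thesis by (simp add: algebra_simps)
    qed
    also have "\<dots> = 2 * K^2 * (\<Sum>p\<in>insert b A. \<Sum>q\<in>{q\<in>insert b A. q \<le> p}. (c p q)^2)"
      using b insert(1) by (simp add: sub sub2 algebra_simps cong: sum.cong)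
    finally show ?case using int2 by simp
  qed
  then show "integrable M (\<lambda>\<omega>. (Q P \<omega>)^2)"
    "expectation (\<lambda>\<omega>. (Q P \<omega>)^2) \<le> 2 * K^2 * (\<Sum>p\<in>P. \<Sum>q\<in>{q\<in>P. q \<le> p}. (c p q)^2)" by auto
qed

end

section \<open>Convergence of series of innovations\<close>

text \<open>
  A bound in mean square passes to almost sure limits, whether or not the limit is known to be integrable.
\<close>
lemma fatou_square_bound:
  fixes f :: "nat \<Rightarrow> 'a \<Rightarrow> real"
  assumes [measurable]: "\<And>n. f n \<in> borel_measurable M"
    and lim: "AE \<omega> in M. (\<lambda>n. f n \<omega>) \<longlonglongrightarrow> F \<omega>"
    and bound: "\<And>n. (\<integral>\<^sup>+\<omega>. ennreal ((f n \<omega>)^2) \<partial>M) \<le> B"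
  shows "(\<integral>\<^sup>+\<omega>. ennreal ((F \<omega>)^2) \<partial>M) \<le> B"
proof -
  have "AE \<omega> in M. ennreal ((F \<omega>)^2) = liminf (\<lambda>n. ennreal ((f n \<omega>)^2))"
    using lim
  proof eventually_elim
    case (elim \<omega>)
    then have "(\<lambda>n. ennreal ((f n \<omega>)^2)) \<longlonglongrightarrow> ennreal ((F \<omega>)^2)"
      by (intro tendsto_ennrealI tendsto_power)
    then show ?case by (rule lim_imp_Liminf[symmetric, rotated]) simp
  qed
  then have "(\<integral>\<^sup>+\<omega>. ennreal ((F \<omega>)^2) \<partial>M) = (\<integral>\<^sup>+\<omega>. liminf (\<lambda>n. ennreal ((f n \<omega>)^2)) \<partial>M)"
    by (rule nn_integral_cong_AE)
  also have "\<dots> \<le> liminf (\<lambda>n. \<integral>\<^sup>+\<omega>. ennreal ((f n \<omega>)^2) \<partial>M)"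
    by (rule nn_integral_liminf) measurable
  also have "\<dots> \<le> limsup (\<lambda>n. \<integral>\<^sup>+\<omega>. ennreal ((f n \<omega>)^2) \<partial>M)"
    by (rule Liminf_le_Limsup) simp
  also have "\<dots> \<le> B"
    by (rule Limsup_bounded) (use bound in auto)
  finally show ?thesis .
qed

lemma summable_tail_tendsto_0:
  fixes f :: "nat \<Rightarrow> real"
  assumes "summable f"
  shows "(\<lambda>m. \<Sum>j. f (m + j)) \<longlonglongrightarrow> 0"
proof -
  have "(\<lambda>m. suminf f - (\<Sum>j<m. f j)) \<longlonglongrightarrow> suminf f - suminf f"
    by (intro tendsto_intros summable_LIMSEQ assms)
  moreover have "suminf f - (\<Sum>j<m. f j) = (\<Sum>j. f (m + j))" for m
    using suminf_split_initial_segment[OF assms, of m] by (simp add: add.commute)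
  ultimately show ?thesis by simp
qed

lemma expectation_Cauchy_Schwarz:
  fixes f g :: "'a \<Rightarrow> real"
  assumes [measurable]: "f \<in> borel_measurable M" "g \<in> borel_measurable M"
    and f2: "integrable M (\<lambda>\<omega>. f \<omega> ^ 2)" and g2: "integrable M (\<lambda>\<omega>. g \<omega> ^ 2)"
  shows "(\<integral>\<omega>. f \<omega> * g \<omega> \<partial>M)^2 \<le> (\<integral>\<omega>. f \<omega> ^ 2 \<partial>M) * (\<integral>\<omega>. g \<omega> ^ 2 \<partial>M)"
proof (cases "integrable M (\<lambda>\<omega>. f \<omega> * g \<omega>)")
  case True
  have "(\<integral>\<^sup>+\<omega>. ennreal \<bar>f \<omega> * g \<omega>\<bar> \<partial>M) ^ 2 \<le> (\<integral>\<^sup>+\<omega>. ennreal (f \<omega> ^ 2) \<partial>M) * (\<integral>\<^sup>+\<omega>. ennreal (g \<omega> ^ 2) \<partial>M)"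
    using Cauchy_Schwarz_nn_integral[of "\<lambda>\<omega>. ennreal \<bar>f \<omega>\<bar>" M "\<lambda>\<omega>. ennreal \<bar>g \<omega>\<bar>"]
    by (simp add: ennreal_mult abs_mult ennreal_power)
  then have "ennreal ((\<integral>\<omega>. \<bar>f \<omega> * g \<omega>\<bar> \<partial>M)^2) \<le> ennreal ((\<integral>\<omega>. f \<omega> ^ 2 \<partial>M) * (\<integral>\<omega>. g \<omega> ^ 2 \<partial>M))"
    using True f2 g2 by (simp add: nn_integral_eq_integral ennreal_mult ennreal_power)
  then have "(\<integral>\<omega>. \<bar>f \<omega> * g \<omega>\<bar> \<partial>M)^2 \<le> (\<integral>\<omega>. f \<omega> ^ 2 \<partial>M) * (\<integral>\<omega>. g \<omega> ^ 2 \<partial>M)"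
    by (subst (asm) ennreal_le_iff) auto
  moreover have "\<bar>\<integral>\<omega>. f \<omega> * g \<omega> \<partial>M\<bar> \<le> (\<integral>\<omega>. \<bar>f \<omega> * g \<omega>\<bar> \<partial>M)"
    by (rule integral_abs_bound)
  then have "\<bar>\<integral>\<omega>. f \<omega> * g \<omega> \<partial>M\<bar> ^ 2 \<le> (\<integral>\<omega>. \<bar>f \<omega> * g \<omega>\<bar> \<partial>M)^2"
    by (rule power_mono) simp
  ultimately show ?thesis by simp
qed (simp add: not_integrable_integral_eq)

context indep_innovations
begin

text \<open>
  The partial sums frozen at the first time their modulus reaches \<open>r\<close>. The increment is multiplied by
  a function of the earlier variables only, so the variances still add up, and the final value of the
  stopped sum remembers every earlier excursion. This yields Kolmogorov's maximal inequality from
  Chebyshev's.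
\<close>
primrec stopped :: "real \<Rightarrow> (nat \<Rightarrow> real) \<Rightarrow> (nat \<Rightarrow> int) \<Rightarrow> nat \<Rightarrow> 'a \<Rightarrow> real" where
  "stopped r c e 0 = (\<lambda>_. 0)"
| "stopped r c e (Suc k) =
     (\<lambda>\<omega>. stopped r c e k \<omega> + (if \<bar>stopped r c e k \<omega>\<bar> < r then c k else 0) * X (e k) \<omega>)"

lemma determined_by_stopped: "determined_by (e ` {..<k}) (stopped r c e k)"
proof (induction k)
  case (Suc k)
  have 1: "determined_by (e ` {..<Suc k}) (stopped r c e k)"
    by (rule determined_by_mono[OF Suc]) auto
  have 2: "determined_by (e ` {..<Suc k}) (\<lambda>\<omega>. if \<bar>stopped r c e k \<omega>\<bar> < r then c k else 0)"
    by (rule determined_by_comp2[OF 1 determined_by_const, where h = "\<lambda>a b. if \<bar>a\<bar> < r then c k else 0"]) measurable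
  show ?case
    by (simp, intro determined_by_add determined_by_times 1 2 determined_by_coord) auto
qed (simp add: determined_by_const)

lemma stopped_square:
  fixes e :: "nat \<Rightarrow> int"
  assumes "inj e"
  shows "integrable M (\<lambda>\<omega>. stopped r c e k \<omega> ^ 2) \<and>
    expectation (\<lambda>\<omega>. stopped r c e k \<omega> ^ 2) \<le> K * (\<Sum>j<k. c j ^ 2)"
proof (induction k)
  case (Suc k)
  define Z where "Z = (\<lambda>\<omega>. if \<bar>stopped r c e k \<omega>\<bar> < r then c k else 0)"
  have pZ: "determined_by (e ` {..<k}) Z" unfolding Z_def
    by (rule determined_by_comp2[OF determined_by_stopped determined_by_const, where h = "\<lambda>a b. if \<bar>a\<bar> < r then c k else 0"]) measurable
  note [measurable] = determined_by_measurable[OF pZ]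
  have Zle: "Z \<omega> ^ 2 \<le> c k ^ 2" for \<omega> by (auto simp: Z_def)
  have Z2: "integrable M (\<lambda>\<omega>. Z \<omega> ^ 2)"
    by (rule integrable_const_bound[of _ "c k ^ 2"]) (use Zle in auto)
  have notin: "e k \<notin> e ` {..<k}" using assms by (auto simp: inj_def)
  note * = square_add_innovation[OF determined_by_stopped pZ notin conjunct1[OF Suc] Z2]
  have "expectation (\<lambda>\<omega>. Z \<omega> ^ 2) \<le> expectation (\<lambda>\<omega>. c k ^ 2)"
    by (rule integral_mono[OF Z2]) (use Zle in auto)
  then have "expectation (\<lambda>\<omega>. Z \<omega> ^ 2) * \<sigma>2 (e k) \<le> c k ^ 2 * K"
    by (intro mult_mono second_le) (auto simp: prob_space)
  then show ?case using * Suc by (simp add: Z_def algebra_simps)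
qed simp

lemma stopped_detects_excursion:
  assumes "k \<le> n" "\<bar>\<Sum>j<k. c j * X (e j) \<omega>\<bar> \<ge> r"
  shows "\<bar>stopped r c e n \<omega>\<bar> \<ge> r"
proof -
  have "(stopped r c e n \<omega> = (\<Sum>j<n. c j * X (e j) \<omega>) \<and> (\<forall>k<n. \<bar>\<Sum>j<k. c j * X (e j) \<omega>\<bar> < r))
     \<or> \<bar>stopped r c e n \<omega>\<bar> \<ge> r"
    by (induction n) (auto simp: less_Suc_eq)
  then show ?thesis using assms by (metis le_neq_implies_less not_less)
qed

lemma kolmogorov_maximal_inequality:
  fixes e :: "nat \<Rightarrow> int"
  assumes "inj e" "0 < r"
  shows "prob {\<omega>\<in>space M. \<exists>k\<le>n. r \<le> \<bar>\<Sum>j<k. c j * X (e j) \<omega>\<bar>} \<le> K * (\<Sum>j<n. c j ^ 2) / r^2"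
proof -
  note [measurable] = determined_by_measurable[OF determined_by_stopped[of e n r c]]
  have "prob {\<omega>\<in>space M. \<exists>k\<le>n. r \<le> \<bar>\<Sum>j<k. c j * X (e j) \<omega>\<bar>} \<le> prob {\<omega>\<in>space M. r \<le> \<bar>stopped r c e n \<omega>\<bar>}"
    by (rule finite_measure_mono) (auto intro: stopped_detects_excursion)
  also have "\<dots> \<le> expectation (\<lambda>\<omega>. stopped r c e n \<omega> ^ 2) / r^2"
    using stopped_square[OF assms(1)] assms(2) by (intro second_moment_method) auto
  also have "\<dots> \<le> K * (\<Sum>j<n. c j ^ 2) / r^2"
    using stopped_square[OF assms(1)] by (intro divide_right_mono) auto
  finally show ?thesis .
qed

text \<open>
  The maximal inequality, applied to the sums starting at \<open>m\<close>, bounds the probability that they ever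
  exceed \<open>r\<close> by a tail of the convergent series of the \<open>c j ^ 2\<close>. Letting \<open>m\<close> grow, the partial sums
  are almost surely Cauchy.
\<close>
lemma AE_summable_innovations:
  assumes e: "inj e" and c: "summable (\<lambda>j. c j ^ 2)"
  shows "AE \<omega> in M. summable (\<lambda>j. c j * X (e j) \<omega>)"
proof -
  define S where "S = (\<lambda>m k \<omega>. \<Sum>j<k. c (m + j) * X (e (m + j)) \<omega>)"
  have [measurable]: "S m k \<in> borel_measurable M" for m k unfolding S_def by measurable
  have tail: "prob {\<omega>\<in>space M. \<exists>k. r \<le> \<bar>S m k \<omega>\<bar>} \<le> K * (\<Sum>j. c (m + j) ^ 2) / r^2" if "0 < r" for m r
  proof -
    define A where "A = (\<lambda>n. {\<omega>\<in>space M. \<exists>k\<le>n. r \<le> \<bar>S m k \<omega>\<bar>})"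
    have [measurable]: "A n \<in> sets M" for n unfolding A_def by measurable
    have "incseq A" by (auto simp: A_def incseq_def intro: order_trans)
    then have lim: "(\<lambda>n. prob (A n)) \<longlonglongrightarrow> prob (\<Union>n. A n)"
      by (intro finite_Lim_measure_incseq) auto
    have le: "prob (A n) \<le> K * (\<Sum>j. c (m + j) ^ 2) / r^2" for n
    proof -
      have "inj (\<lambda>j. e (m + j))" using injD[OF e] by (fastforce simp: inj_def)
      from kolmogorov_maximal_inequality[OF this \<open>0 < r\<close>, of n "\<lambda>j. c (m + j)"]
      have "prob (A n) \<le> K * (\<Sum>j<n. c (m + j) ^ 2) / r^2" by (simp add: A_def S_def)
      also have "\<dots> \<le> K * (\<Sum>j. c (m + j) ^ 2) / r^2"
        using summable_ignore_initial_segment[OF c, of m] K_ge_1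
        by (intro divide_right_mono mult_left_mono sum_le_suminf) (auto simp: add.commute)
      finally show ?thesis .
    qed
    from lim le have "prob (\<Union>n. A n) \<le> K * (\<Sum>j. c (m + j) ^ 2) / r^2"
      by (intro LIMSEQ_le_const2[where X = "\<lambda>n. prob (A n)"]) auto
    moreover have "(\<Union>n. A n) = {\<omega>\<in>space M. \<exists>k. r \<le> \<bar>S m k \<omega>\<bar>}"
      by (auto simp: A_def)
    ultimately show ?thesis by simp
  qed
  have ev: "AE \<omega> in M. \<exists>m. \<forall>k. \<bar>S m k \<omega>\<bar> < r" if "0 < r" for r
  proof -
    define N where "N = {\<omega>\<in>space M. \<forall>m. \<exists>k. r \<le> \<bar>S m k \<omega>\<bar>}"
    have [measurable]: "N \<in> sets M" unfolding N_def by measurable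
    have "prob N \<le> K * (\<Sum>j. c (m + j) ^ 2) / r^2" for m
    proof -
      have "prob N \<le> prob {\<omega>\<in>space M. \<exists>k. r \<le> \<bar>S m k \<omega>\<bar>}"
        by (rule finite_measure_mono) (auto simp: N_def)
      with tail[OF that, of m] show ?thesis by simp
    qed
    moreover have "(\<lambda>m. K * (\<Sum>j. c (m + j) ^ 2) / r^2) \<longlonglongrightarrow> K * 0 / r^2"
      by (intro tendsto_intros summable_tail_tendsto_0[OF c]) (use that in auto)
    ultimately have "prob N \<le> 0"
      by (intro LIMSEQ_le_const[where X = "\<lambda>m. K * (\<Sum>j. c (m + j) ^ 2) / r^2"]) auto
    then have "prob N = 0" by (simp add: measure_le_0_iff)
    then have "N \<in> null_sets M" by (auto simp: emeasure_eq_measure)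
    then show ?thesis by (rule AE_I') (auto simp: N_def not_less)
  qed
  have "AE \<omega> in M. \<forall>r::nat. \<exists>m. \<forall>k. \<bar>S m k \<omega>\<bar> < 1 / real (Suc r)"
    unfolding AE_all_countable using ev by simp
  then show ?thesis
  proof eventually_elim
    case (elim \<omega>)
    show ?case
      unfolding summable_Cauchy
    proof (intro allI impI)
      fix \<delta> :: real assume "0 < \<delta>"
      then obtain r where r: "1 / real (Suc r) < \<delta> / 2"
        using reals_Archimedean[of "\<delta> / 2"] by (auto simp: inverse_eq_divide)
      obtain m where m: "\<And>k. \<bar>S m k \<omega>\<bar> < 1 / real (Suc r)" using elim by blast
      have "norm (\<Sum>j=a..<b. c j * X (e j) \<omega>) < \<delta>" if "m \<le> a" for a b
      proof (cases "a \<le> b")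
        case True
        have sh: "(\<Sum>j<k. c (m + j) * X (e (m + j)) \<omega>) = (\<Sum>j=m..<m+k. c j * X (e j) \<omega>)" for k
          using sum.shift_bounds_nat_ivl[of "\<lambda>j. c j * X (e j) \<omega>" 0 m k]
          by (simp add: atLeast0LessThan add.commute)
        have "(\<Sum>j=a..<b. c j * X (e j) \<omega>) = S m (b - m) \<omega> - S m (a - m) \<omega>"
          unfolding S_def sh
          using that True sum.atLeastLessThan_concat[of m a b "\<lambda>j. c j * X (e j) \<omega>"] by simp
        then show ?thesis using m[of "b - m"] m[of "a - m"] r unfolding real_norm_def by linarith
      qed (use \<open>0 < \<delta>\<close> in auto)
      then show "\<exists>N. \<forall>a\<ge>N. \<forall>b. norm (\<Sum>j=a..<b. c j * X (e j) \<omega>) < \<delta>" by blast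
    qed
  qed
qed

text \<open>
  The second moments of the finite sums \<open>\<Sum>n\<le>j<n+k. c j * X (e j)\<close> are bounded uniformly in \<open>k\<close>, and these
  sums converge almost surely to the difference in the integrand.
\<close>
lemma linear_form_tail_L2:
  assumes e: "inj e" and c: "summable (\<lambda>j. c j ^ 2)"
  shows "(\<integral>\<^sup>+\<omega>. ennreal (((\<Sum>j. c j * X (e j) \<omega>) - (\<Sum>j<n. c j * X (e j) \<omega>))^2) \<partial>M)
          \<le> ennreal (K * (\<Sum>j. c (n + j) ^ 2))"
proof (rule fatou_square_bound)
  fix k
  define p where "p = inv e"
  have p [simp]: "p (e j) = j" for j unfolding p_def using e by simp
  have eq: "(\<Sum>j<k. c (n + j) * X (e (n + j)) \<omega>) = (\<Sum>x\<in>(\<lambda>j. e (n + j)) ` {..<k}. c (p x) * X x \<omega>)" for \<omega>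
    by (subst sum.reindex) (auto simp: inj_on_def dest: injD[OF e])
  have "(\<Sum>x\<in>(\<lambda>j. e (n + j)) ` {..<k}. c (p x) ^ 2 * \<sigma>2 x) = (\<Sum>j<k. c (n + j) ^ 2 * \<sigma>2 (e (n + j)))"
    by (subst sum.reindex) (auto simp: inj_on_def dest: injD[OF e])
  also have "\<dots> \<le> (\<Sum>j<k. c (n + j) ^ 2 * K)"
    by (intro sum_mono mult_left_mono second_le) auto
  also have "\<dots> = K * (\<Sum>j<k. c (n + j) ^ 2)" by (simp add: sum_distrib_left mult.commute)
  also have "\<dots> \<le> K * (\<Sum>j. c (n + j) ^ 2)"
    using summable_ignore_initial_segment[OF c, of n] K_ge_1
    by (intro mult_left_mono sum_le_suminf) (auto simp: add.commute)
  finally have le: "(\<Sum>x\<in>(\<lambda>j. e (n + j)) ` {..<k}. c (p x) ^ 2 * \<sigma>2 x) \<le> K * (\<Sum>j. c (n + j) ^ 2)" .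
  show "(\<integral>\<^sup>+\<omega>. ennreal ((\<Sum>j<k. c (n + j) * X (e (n + j)) \<omega>)^2) \<partial>M) \<le> ennreal (K * (\<Sum>j. c (n + j) ^ 2))"
    unfolding eq using le by (subst nn_integral_eq_integral) (auto simp: linear_form_square intro: ennreal_leI)
next
  show "AE \<omega> in M. (\<lambda>k. \<Sum>j<k. c (n + j) * X (e (n + j)) \<omega>) \<longlonglongrightarrow>
           (\<Sum>j. c j * X (e j) \<omega>) - (\<Sum>j<n. c j * X (e j) \<omega>)"
    using AE_summable_innovations[OF e c]
  proof eventually_elim
    case (elim \<omega>)
    have "(\<lambda>j. c (j + n) * X (e (j + n)) \<omega>) sums ((\<Sum>j. c j * X (e j) \<omega>) - (\<Sum>j<n. c j * X (e j) \<omega>))"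
      using elim by (intro sums_split_initial_segment summable_sums)
    then show ?case by (simp add: sums_def add.commute)
  qed
qed measurable

text \<open>
  Identifies the centring constants of the partial sums. Both finite sums converge in \<open>L\<^sup>2\<close>, and by the
  Cauchy-Schwarz inequality the mean of a product is continuous there; for the finite sums it is computed
  from the orthogonality of the innovations.
\<close>
lemma expectation_product_of_linear_forms:
  assumes e: "inj e" and c: "summable (\<lambda>j. c j ^ 2)" and d: "summable (\<lambda>j. d j ^ 2)"
  shows "(\<lambda>n. \<Sum>j<n. c j * d j * \<sigma>2 (e j)) \<longlonglongrightarrow>
     expectation (\<lambda>\<omega>. (\<Sum>j. c j * X (e j) \<omega>) * (\<Sum>j. d j * X (e j) \<omega>))"
proof -
  define u where "u = (\<lambda>c n \<omega>. \<Sum>j<n. c j * X (e j) \<omega>)"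
  define U where "U = (\<lambda>c \<omega>. \<Sum>j. c j * X (e j) \<omega>)"
  have [measurable]: "u c n \<in> borel_measurable M" "U c \<in> borel_measurable M" for c n
    unfolding u_def U_def by measurable
  have tail: "(\<integral>\<^sup>+\<omega>. ennreal ((U c \<omega> - u c n \<omega>)^2) \<partial>M) \<le> ennreal (K * (\<Sum>j. c (n + j) ^ 2))"
    if "summable (\<lambda>j. c j ^ 2)" for c n
    using linear_form_tail_L2[OF e that] by (simp add: U_def u_def)
  have U2: "integrable M (\<lambda>\<omega>. U c \<omega> ^ 2)" if "summable (\<lambda>j. c j ^ 2)" for c
    using tail[OF that, of 0] by (intro integrableI_bounded) (auto simp: u_def intro: le_less_trans)
  have ud: "integrable M (\<lambda>\<omega>. (U c \<omega> - u c n \<omega>) ^ 2)" if "summable (\<lambda>j. c j ^ 2)" for c n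
    using tail[OF that, of n] by (intro integrableI_bounded) (auto intro: le_less_trans)
  have u2: "integrable M (\<lambda>\<omega>. u c n \<omega> ^ 2)" for c n
  proof -
    define p where "p = inv e"
    have p [simp]: "p (e j) = j" for j unfolding p_def using e by simp
    have "u c n \<omega> = (\<Sum>x\<in>e ` {..<n}. c (p x) * X x \<omega>)" for \<omega>
      unfolding u_def by (subst sum.reindex) (auto simp: inj_on_def dest: injD[OF e])
    then show ?thesis using linear_form_square(2)[of "e ` {..<n}" "\<lambda>x. c (p x)"] by simp
  qed
  have prods: "expectation (\<lambda>\<omega>. u c n \<omega> * u d n \<omega>) = (\<Sum>j<n. c j * d j * \<sigma>2 (e j))" for n
  proof -
    have eq: "(\<lambda>\<omega>. u c n \<omega> * u d n \<omega>) = (\<lambda>\<omega>. \<Sum>i<n. \<Sum>j<n. c i * d j * (X (e i) \<omega> * X (e j) \<omega>))"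
      by (rule ext) (simp add: u_def sum_product mult_ac)
    have "expectation (\<lambda>\<omega>. u c n \<omega> * u d n \<omega>) = (\<Sum>i<n. \<Sum>j<n. c i * d j * expectation (\<lambda>\<omega>. X (e i) \<omega> * X (e j) \<omega>))"
      unfolding eq by (simp add: integrable_X_mult)
    also have "\<dots> = (\<Sum>i<n. \<Sum>j<n. if i = j then c i * d j * \<sigma>2 (e i) else 0)"
      using e by (intro sum.cong refl) (auto simp: expectation_X_mult inj_def)
    finally show ?thesis by (simp add: sum.delta)
  qed
  define x where "x = (\<lambda>c n \<omega>. U c \<omega> - u c n \<omega>)"
  have [measurable]: "x c n \<in> borel_measurable M" for c n unfolding x_def by measurable
  have x2: "integrable M (\<lambda>\<omega>. x c n \<omega> ^ 2)" "expectation (\<lambda>\<omega>. x c n \<omega> ^ 2) \<le> K * (\<Sum>j. c (n + j) ^ 2)"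
    if c: "summable (\<lambda>j. c j ^ 2)" for c n
  proof -
    show *: "integrable M (\<lambda>\<omega>. x c n \<omega> ^ 2)" unfolding x_def by (rule ud[OF c])
    have "0 \<le> (\<Sum>j. c (n + j) ^ 2)"
      using summable_ignore_initial_segment[OF c, of n] by (intro suminf_nonneg) (auto simp: add.commute)
    then show "expectation (\<lambda>\<omega>. x c n \<omega> ^ 2) \<le> K * (\<Sum>j. c (n + j) ^ 2)"
      using tail[OF c, of n] nn_integral_eq_integral[OF *] K_ge_1 by (simp add: x_def)
  qed
  have x0: "(\<lambda>n. expectation (\<lambda>\<omega>. x c n \<omega> ^ 2)) \<longlonglongrightarrow> 0" if c: "summable (\<lambda>j. c j ^ 2)" for c
  proof (rule tendsto_sandwich[OF _ _ tendsto_const])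
    show "(\<lambda>n. K * (\<Sum>j. c (n + j) ^ 2)) \<longlonglongrightarrow> 0"
      using tendsto_mult_left[OF summable_tail_tendsto_0[OF c], of K] by simp
  qed (use x2[OF c] in auto)
  have cross: "(\<lambda>n. expectation (\<lambda>\<omega>. x c n \<omega> * g n \<omega>)) \<longlonglongrightarrow> 0"
    if c: "summable (\<lambda>j. c j ^ 2)" and g [measurable]: "\<And>n. g n \<in> borel_measurable M"
      and g2: "\<And>n. integrable M (\<lambda>\<omega>. g n \<omega> ^ 2)"
      and G: "(\<lambda>n. expectation (\<lambda>\<omega>. g n \<omega> ^ 2)) \<longlonglongrightarrow> G" for c g G
  proof -
    have "(\<lambda>n. (expectation (\<lambda>\<omega>. x c n \<omega> * g n \<omega>))^2) \<longlonglongrightarrow> 0"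
    proof (rule tendsto_sandwich[OF _ _ tendsto_const])
      show "(\<lambda>n. expectation (\<lambda>\<omega>. x c n \<omega> ^ 2) * expectation (\<lambda>\<omega>. g n \<omega> ^ 2)) \<longlonglongrightarrow> 0"
        using tendsto_mult[OF x0[OF c] G] by simp
    qed (use x2(1)[OF c] g2 in \<open>auto intro!: always_eventually expectation_Cauchy_Schwarz\<close>)
    from tendsto_real_sqrt[OF this] show ?thesis by (simp add: tendsto_rabs_zero_iff)
  qed
  have int: "integrable M (\<lambda>\<omega>. f \<omega> * g \<omega>)" if "f \<in> borel_measurable M" "g \<in> borel_measurable M"
     "integrable M (\<lambda>\<omega>. f \<omega> ^ 2)" "integrable M (\<lambda>\<omega>. g \<omega> ^ 2)" for f g :: "'a \<Rightarrow> real"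
    using integrable_prod_of_squares that by blast
  have split: "expectation (\<lambda>\<omega>. u c n \<omega> * u d n \<omega>) = expectation (\<lambda>\<omega>. U c \<omega> * U d \<omega>)
      - expectation (\<lambda>\<omega>. x c n \<omega> * U d \<omega>) - expectation (\<lambda>\<omega>. x d n \<omega> * U c \<omega>) + expectation (\<lambda>\<omega>. x c n \<omega> * x d n \<omega>)" for n
  proof -
    have eq: "(\<lambda>\<omega>. u c n \<omega> * u d n \<omega>) = (\<lambda>\<omega>. U c \<omega> * U d \<omega> - x c n \<omega> * U d \<omega> - x d n \<omega> * U c \<omega> + x c n \<omega> * x d n \<omega>)"
      by (rule ext) (simp add: x_def algebra_simps)
    show ?thesis unfolding eq
      by (simp add: int U2[OF c] U2[OF d] x2[OF c] x2[OF d])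
  qed
  have "(\<lambda>n. expectation (\<lambda>\<omega>. x c n \<omega> * U d \<omega>)) \<longlonglongrightarrow> 0"
    by (rule cross[OF c _ U2[OF d] tendsto_const]) measurable
  moreover have "(\<lambda>n. expectation (\<lambda>\<omega>. x d n \<omega> * U c \<omega>)) \<longlonglongrightarrow> 0"
    by (rule cross[OF d _ U2[OF c] tendsto_const]) measurable
  moreover have "(\<lambda>n. expectation (\<lambda>\<omega>. x c n \<omega> * x d n \<omega>)) \<longlonglongrightarrow> 0"
    by (rule cross[OF c _ x2(1)[OF d] x0[OF d]]) measurable
  ultimately have "(\<lambda>n. expectation (\<lambda>\<omega>. u c n \<omega> * u d n \<omega>)) \<longlonglongrightarrow> expectation (\<lambda>\<omega>. U c \<omega> * U d \<omega>) - 0 - 0 + 0"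
    unfolding split by (intro tendsto_intros)
  then show ?thesis by (simp add: prods U_def)
qed

end

section \<open>Sums of powers and the energy of the residual coefficients\<close>

lemma powr_square: "(x powr a)^2 = x powr (2 * a)" for x a :: real
  by (simp add: power2_eq_square flip: powr_add)

text \<open>
  Mean value theorem for \<open>y powr (- x)\<close>: the terms of the series telescope.
\<close>
lemma powr_neg_step:
  fixes x y :: real
  assumes "0 < x" "0 < y"
  shows "x * (y + 1) powr (- 1 - x) \<le> y powr (- x) - (y + 1) powr (- x)"
proof -
  have "\<exists>z. y < z \<and> z < y + 1 \<and> (y + 1) powr (- x) - y powr (- x) = (y + 1 - y) * (- x * z powr (- x - 1))"
    using assms by (intro MVT2) (auto intro!: derivative_eq_intros simp: powr_diff)
  then obtain z where z: "y < z" "z < y + 1" "(y + 1) powr (- x) - y powr (- x) = - x * z powr (- x - 1)"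
    by auto
  have "(y + 1) powr (- 1 - x) \<le> z powr (- 1 - x)"
    using z assms by (intro powr_mono2') auto
  then have "x * (y + 1) powr (- 1 - x) \<le> x * z powr (- 1 - x)"
    using assms by simp
  moreover have "- x - 1 = - 1 - x" by simp
  ultimately show ?thesis using z(3) by (simp only:)
qed

lemma sum_powr_tail_le:
  fixes x :: real
  assumes x: "0 < x" and r: "1 \<le> r"
  shows "(\<Sum>j=r..m. real j powr (- 1 - x)) \<le> (1 + 1 / x) * real r powr (- x)"
proof (cases "r \<le> m")
  case True
  have "(\<Sum>j=r..m. real j powr (- 1 - x)) \<le> real r powr (- 1 - x) + (real r powr (- x) - real m powr (- x)) / x"
    using True
  proof (induction m rule: dec_induct)
    case (step m)
    have "real (Suc m) powr (- 1 - x) \<le> (real m powr (- x) - real (Suc m) powr (- x)) / x"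
      using powr_neg_step[OF x, of "real m"] step r x
      by (simp add: pos_le_divide_eq mult.commute add.commute)
    with step show ?case using x by (simp add: diff_divide_distrib)
  qed simp
  also have "\<dots> \<le> real r powr (- x) + real r powr (- x) / x"
    using x r by (intro add_mono powr_mono divide_right_mono) auto
  finally show ?thesis by (simp add: algebra_simps)
qed (use x in auto)

lemma sum_powr_initial_le:
  fixes x :: real
  assumes x: "0 < x" "x < 1"
  shows "(\<Sum>j=1..n. real j powr (- x)) \<le> real n powr (1 - x) / (1 - x)"
proof (induction n)
  case (Suc n)
  have "(1 - x) * real (Suc n) powr (- x) \<le> real (Suc n) powr (1 - x) - real n powr (1 - x)"
  proof (cases "n = 0")
    case False
    have "\<exists>z. real n < z \<and> z < real n + 1 \<and> (real n + 1) powr (1 - x) - real n powr (1 - x) =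
       (real n + 1 - real n) * ((1 - x) * z powr (1 - x - 1))"
      using False by (intro MVT2 has_real_derivative_powr) auto
    then obtain z where z: "real n < z" "z < real n + 1"
      "(real n + 1) powr (1 - x) - real n powr (1 - x) = (1 - x) * z powr (- x)" by auto
    have "(1 - x) * (real n + 1) powr (- x) \<le> (1 - x) * z powr (- x)"
      using z x by (intro mult_left_mono powr_mono2') auto
    with z show ?thesis by (simp add: add.commute)
  qed (use x in auto)
  then have "real (Suc n) powr (- x) \<le> (real (Suc n) powr (1 - x) - real n powr (1 - x)) / (1 - x)"
    using x by (simp add: pos_le_divide_eq mult.commute)
  with Suc show ?case by (simp add: diff_divide_distrib)
qed simp

definition decay :: "real \<Rightarrow> nat \<Rightarrow> real" where
  "decay \<theta> j = max 1 (real j) powr (- (3/4) - \<theta> / 2)"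

lemma decay_nonneg: "0 \<le> decay \<theta> j"
  by (simp add: decay_def)

text \<open>
  The exponent \<open>3/4 + \<theta>/2\<close> of the second factor is split as \<open>1/4 + (1/2 + \<theta>/2)\<close>. The first part is
  given to \<open>j\<close>, making its power summable, and in the second part \<open>j + l\<close> is replaced by \<open>r + l\<close>, a bound
  whose square is summable in \<open>l\<close>.
\<close>
lemma decay_product_le:
  assumes \<theta>: "0 < \<theta>" and r: "1 \<le> r" "r \<le> j"
  shows "decay \<theta> j * decay \<theta> (j + l) \<le> real j powr (- 1 - \<theta>/2) * real (r + l) powr (- (1/2) - \<theta>/2)"
proof -
  have e: "- (3/4) - \<theta>/2 = - (1/4) + (- (1/2) - \<theta>/2)" by simp
  have "decay \<theta> (j + l) = real (j + l) powr (- (1/4)) * real (j + l) powr (- (1/2) - \<theta>/2)"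
    using r unfolding decay_def e powr_add by (simp add: max_def)
  also have "\<dots> \<le> real j powr (- (1/4)) * real (r + l) powr (- (1/2) - \<theta>/2)"
    using r \<theta> by (intro mult_mono powr_mono2') auto
  finally have "decay \<theta> j * decay \<theta> (j + l) \<le> real j powr (- (3/4) - \<theta>/2) * (real j powr (- (1/4)) * real (r + l) powr (- (1/2) - \<theta>/2))"
    using r by (auto simp: decay_def max_def intro!: mult_left_mono)
  also have "\<dots> = real j powr (- (3/4) - \<theta>/2 + - (1/4)) * real (r + l) powr (- (1/2) - \<theta>/2)"
    by (simp only: powr_add mult.assoc)
  finally show ?thesis by simp
qed

text \<open>
  The first bound serves tails and blocks near the window. The second one has the additional decay in
  \<open>r\<close> needed to sum over the blocks of length \<open>n\<close> that start further away than \<open>n\<close>.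
\<close>
lemma decay_product_block_le:
  assumes \<theta>: "0 < \<theta>" and r: "1 \<le> r"
  shows "(\<Sum>j=r..m. decay \<theta> j * decay \<theta> (j + l)) \<le> (1 + 2/\<theta>) * real (r + l) powr (- (1/2) - \<theta>/2)"
    and "(\<Sum>j=r..<r+n. decay \<theta> j * decay \<theta> (j + l)) \<le>
           (real n * real r powr (- 1 - \<theta>/2)) * real (r + l) powr (- (1/2) - \<theta>/2)"
proof -
  let ?p = "real (r + l) powr (- (1/2) - \<theta>/2)"
  have "(\<Sum>j=r..m. decay \<theta> j * decay \<theta> (j + l)) \<le> (\<Sum>j=r..m. real j powr (- 1 - \<theta>/2)) * ?p"
    unfolding sum_distrib_right using r by (intro sum_mono decay_product_le[OF \<theta>]) auto
  also have "(\<Sum>j=r..m. real j powr (- 1 - \<theta>/2)) \<le> (1 + 1/(\<theta>/2)) * real r powr (- (\<theta>/2))"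
    using \<theta> r by (intro sum_powr_tail_le) auto
  also have "\<dots> \<le> (1 + 2/\<theta>) * 1"
    using \<theta> r powr_mono2'[of "\<theta>/2" 1 "real r"] by (intro mult_mono) (auto simp: powr_minus_divide ge_one_powr_ge_zero)
  finally show "(\<Sum>j=r..m. decay \<theta> j * decay \<theta> (j + l)) \<le> (1 + 2/\<theta>) * ?p"
    by (simp add: mult_right_mono)
  have "(\<Sum>j=r..<r+n. decay \<theta> j * decay \<theta> (j + l)) \<le> (\<Sum>j=r..<r+n. real r powr (- 1 - \<theta>/2) * ?p)"
  proof (rule sum_mono)
    fix j assume j: "j \<in> {r..<r+n}"
    have "decay \<theta> j * decay \<theta> (j + l) \<le> real j powr (- 1 - \<theta>/2) * ?p"
      using r j by (intro decay_product_le[OF \<theta>]) auto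
    also have "\<dots> \<le> real r powr (- 1 - \<theta>/2) * ?p"
      using r j \<theta> by (intro mult_right_mono powr_mono2') auto
    finally show "decay \<theta> j * decay \<theta> (j + l) \<le> real r powr (- 1 - \<theta>/2) * ?p" .
  qed
  then show "(\<Sum>j=r..<r+n. decay \<theta> j * decay \<theta> (j + l)) \<le> (real n * real r powr (- 1 - \<theta>/2)) * ?p"
    by simp
qed

lemma summable_decay_product:
  assumes \<theta>: "0 < \<theta>" shows "summable (\<lambda>j. decay \<theta> j * decay \<theta> (j + l))"
proof -
  have "summable (\<lambda>j. decay \<theta> (j + 1) * decay \<theta> (j + 1 + l))"
  proof (rule summableI_nonneg_bounded)
    fix n
    have "(\<Sum>j<n. decay \<theta> (j + 1) * decay \<theta> (j + 1 + l)) = (\<Sum>j=1..n. decay \<theta> j * decay \<theta> (j + l))"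
      by (rule sum.reindex_bij_witness[of _ "\<lambda>j. j - 1" Suc]) auto
    then show "(\<Sum>j<n. decay \<theta> (j + 1) * decay \<theta> (j + 1 + l)) \<le> (1 + 2/\<theta>) * real (1 + l) powr (- (1/2) - \<theta>/2)"
      using decay_product_block_le(1)[OF \<theta>, of 1 l n] by simp
  qed (simp add: decay_nonneg)
  then show ?thesis by (subst (asm) summable_iff_shift)
qed

lemma summable_square_of_decay:
  assumes \<theta>: "0 < \<theta>" and \<gamma>: "\<And>j. \<bar>\<gamma> j\<bar> \<le> C * decay \<theta> j"
  shows "summable (\<lambda>j. \<gamma> j ^ 2)"
proof (rule summable_comparison_test')
  show "summable (\<lambda>j. C^2 * (decay \<theta> j * decay \<theta> (j + 0)))"
    by (intro summable_mult summable_decay_product \<theta>)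
  fix j
  have "\<bar>\<gamma> j\<bar> ^ 2 \<le> (C * decay \<theta> j)^2" using \<gamma> by (intro power_mono) auto
  then show "norm (\<gamma> j ^ 2) \<le> C^2 * (decay \<theta> j * decay \<theta> (j + 0))"
    by (simp add: power2_eq_square mult_ac)
qed

lemma decay_product_tail_le:
  assumes \<theta>: "0 < \<theta>" and r: "1 \<le> r"
  shows "(\<Sum>j. decay \<theta> (r + j) * decay \<theta> (r + j + l)) \<le> (1 + 2/\<theta>) * real (r + l) powr (- (1/2) - \<theta>/2)"
proof (rule suminf_le_const)
  show "summable (\<lambda>j. decay \<theta> (r + j) * decay \<theta> (r + j + l))"
    using summable_ignore_initial_segment[OF summable_decay_product[OF \<theta>], of r l] by (simp add: add.commute)
  fix n
  have "(\<Sum>j<n. decay \<theta> (r + j) * decay \<theta> (r + j + l)) = (\<Sum>j=r..<r+n. decay \<theta> j * decay \<theta> (j + l))"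
    by (rule sum.reindex_bij_witness[of _ "\<lambda>j. j - r" "\<lambda>j. r + j"]) auto
  also have "\<dots> \<le> (\<Sum>j=r..r+n. decay \<theta> j * decay \<theta> (j + l))"
    by (rule sum_mono2) (auto simp: decay_nonneg)
  also have "\<dots> \<le> (1 + 2/\<theta>) * real (r + l) powr (- (1/2) - \<theta>/2)"
    by (rule decay_product_block_le[OF \<theta> r])
  finally show "(\<Sum>j<n. decay \<theta> (r + j) * decay \<theta> (r + j + l)) \<le> (1 + 2/\<theta>) * real (r + l) powr (- (1/2) - \<theta>/2)" .
qed

text \<open>
  The coefficient of \<open>\<eta> p q\<close> in the difference between the partial sum over \<open>m < i \<le> m + n\<close> and the
  martingale increment, for \<open>q \<le> p\<close>.
\<close>
definition residual_coef :: "(nat \<Rightarrow> nat \<Rightarrow> real) \<Rightarrow> nat \<Rightarrow> nat \<Rightarrow> int \<Rightarrow> int \<Rightarrow> real" where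
  "residual_coef f m n p q =
     (\<Sum>i\<in>{i\<in>{m+1..m+n}. p \<le> int i}. f (nat (p - q)) (nat (int i - p)))
     - (if int m < p then \<Sum>j. f (nat (p - q)) j else 0)"

text \<open>
  The factor \<open>1 + 1/\<theta>\<close> comes from the sum over the lags. In the second factor, the fraction
  accounts for the \<open>n\<close> indices \<open>p\<close> of the window and the \<open>n\<close> indices just before it, and the summand 2
  for all earlier ones.
\<close>
definition energy_const :: "real \<Rightarrow> real" where
  "energy_const \<theta> = (1 + 1/\<theta>) * ((1 + 2/\<theta>)^2 * 2 / (1 - \<theta>) + 2)"

context
  fixes \<theta> W :: real and f :: "nat \<Rightarrow> nat \<Rightarrow> real"
  assumes \<theta>: "0 < \<theta>" "\<theta> < 1" 
    and f_le: "\<And>l j. \<bar>f l j\<bar> \<le> W * (decay \<theta> j * decay \<theta> (j + l))"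
begin

lemma decay_bound_nonneg: "0 \<le> W"
proof -
  have "0 < decay \<theta> 0" by (simp add: decay_def)
  with order_trans[OF abs_ge_zero f_le[of 0 0]] show ?thesis
    by (metis add_0 mult_pos_pos zero_le_mult_iff not_less)
qed

lemma summable_of_decay_bound: "summable (f l)"
  by (rule summable_comparison_test'[OF summable_mult[OF summable_decay_product[OF \<theta>(1)]]]) (use f_le in auto)

text \<open>
  For \<open>p\<close> in the window the terms \<open>j < r\<close> of the series cancel, where \<open>r = m + n + 1 - p\<close>, and
  \<open>r + l = m + n + 1 - q\<close> for the lag \<open>l = p - q\<close>.
\<close>
lemma residual_coef_inside:
  assumes "int m < p" "p \<le> int (m + n)" "q \<le> p"
  shows "\<bar>residual_coef f m n p q\<bar> \<le> W * (1 + 2/\<theta>) * real_of_int (int (m + n) + 1 - q) powr (- (1/2) - \<theta>/2)"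
proof -
  define l where "l = nat (p - q)"
  define r where "r = nat (int (m + n) + 1 - p)"
  have r: "1 \<le> r" using assms by (auto simp: r_def)
  have rl: "real (r + l) = real_of_int (int (m + n) + 1 - q)"
    using assms by (simp add: r_def l_def)
  have "(\<Sum>i\<in>{i\<in>{m+1..m+n}. p \<le> int i}. f l (nat (int i - p))) = (\<Sum>j<r. f l j)"
    using assms by (intro sum.reindex_bij_witness[of _ "\<lambda>j. nat (int j + p)" "\<lambda>i. nat (int i - p)"]) (auto simp: r_def)
  then have "residual_coef f m n p q = - (\<Sum>j. f l (r + j))"
    using suminf_split_initial_segment[OF summable_of_decay_bound, of l r] assms
    by (simp add: residual_coef_def l_def[symmetric] add.commute)
  also have "\<bar>\<dots>\<bar> \<le> (\<Sum>j. W * (decay \<theta> (r + j) * decay \<theta> (r + j + l)))"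
  proof -
    have s: "summable (\<lambda>j. W * (decay \<theta> (r + j) * decay \<theta> (r + j + l)))"
      using summable_ignore_initial_segment[OF summable_decay_product[OF \<theta>(1)], of r l]
      by (intro summable_mult) (simp add: add.commute)
    have "norm (\<Sum>j. f l (r + j)) \<le> (\<Sum>j. W * (decay \<theta> (r + j) * decay \<theta> (r + j + l)))"
      by (rule norm_suminf_le[OF _ s]) (use f_le in simp)
    then show ?thesis by simp
  qed
  also have "\<dots> = W * (\<Sum>j. decay \<theta> (r + j) * decay \<theta> (r + j + l))"
    using summable_ignore_initial_segment[OF summable_decay_product[OF \<theta>(1)], of r l]
    by (intro suminf_mult) (simp add: add.commute)
  also have "\<dots> \<le> W * ((1 + 2/\<theta>) * real (r + l) powr (- (1/2) - \<theta>/2))"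
    by (intro mult_left_mono decay_product_tail_le \<theta> r decay_bound_nonneg)
  finally show ?thesis unfolding rl by (simp add: mult.assoc)
qed

text \<open>
  For \<open>p\<close> before the window only the block of the terms \<open>r \<le> j < r + n\<close> is present, where
  \<open>r = m + 1 - p\<close>.
\<close>
lemma residual_coef_before:
  assumes "p \<le> int m" "q \<le> p"
  shows "\<bar>residual_coef f m n p q\<bar> \<le> W * (1 + 2/\<theta>) * real_of_int (int m + 1 - q) powr (- (1/2) - \<theta>/2)"
    and "\<bar>residual_coef f m n p q\<bar> \<le> W * (real n * real_of_int (int m + 1 - p) powr (- 1 - \<theta>/2))
           * real_of_int (int m + 1 - q) powr (- (1/2) - \<theta>/2)"
proof -
  define l where "l = nat (p - q)"
  define r where "r = nat (int m + 1 - p)"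
  have r: "1 \<le> r" using assms by (auto simp: r_def)
  have rl: "real (r + l) = real_of_int (int m + 1 - q)" "real r = real_of_int (int m + 1 - p)"
    using assms by (simp_all add: r_def l_def)
  have "residual_coef f m n p q = (\<Sum>i\<in>{i\<in>{m+1..m+n}. p \<le> int i}. f l (nat (int i - p)))"
    using assms by (simp add: residual_coef_def l_def)
  also have "\<dots> = (\<Sum>j=r..<r+n. f l j)"
    using assms by (intro sum.reindex_bij_witness[of _ "\<lambda>j. nat (int j + p)" "\<lambda>i. nat (int i - p)"]) (auto simp: r_def)
  also have "\<bar>\<dots>\<bar> \<le> (\<Sum>j=r..<r+n. W * (decay \<theta> j * decay \<theta> (j + l)))"
    by (rule order_trans[OF sum_abs sum_mono]) (rule f_le)
  finally have *: "\<bar>residual_coef f m n p q\<bar> \<le> W * (\<Sum>j=r..<r+n. decay \<theta> j * decay \<theta> (j + l))"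
    by (simp add: sum_distrib_left)
  have "(\<Sum>j=r..<r+n. decay \<theta> j * decay \<theta> (j + l)) \<le> (\<Sum>j=r..r+n. decay \<theta> j * decay \<theta> (j + l))"
    by (rule sum_mono2) (auto simp: decay_nonneg)
  also have "\<dots> \<le> (1 + 2/\<theta>) * real (r + l) powr (- (1/2) - \<theta>/2)"
    by (rule decay_product_block_le[OF \<theta>(1) r])
  finally have "W * (\<Sum>j=r..<r+n. decay \<theta> j * decay \<theta> (j + l)) \<le> W * ((1 + 2/\<theta>) * real (r + l) powr (- (1/2) - \<theta>/2))"
    by (intro mult_left_mono decay_bound_nonneg)
  with * show "\<bar>residual_coef f m n p q\<bar> \<le> W * (1 + 2/\<theta>) * real_of_int (int m + 1 - q) powr (- (1/2) - \<theta>/2)"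
    unfolding rl by (simp add: mult.assoc)
  have "W * (\<Sum>j=r..<r+n. decay \<theta> j * decay \<theta> (j + l)) \<le> W * (real n * real r powr (- 1 - \<theta>/2) * real (r + l) powr (- (1/2) - \<theta>/2))"
    by (intro mult_left_mono decay_bound_nonneg decay_product_block_le[OF \<theta>(1) r])
  with * show "\<bar>residual_coef f m n p q\<bar> \<le> W * (real n * real_of_int (int m + 1 - p) powr (- 1 - \<theta>/2))
           * real_of_int (int m + 1 - q) powr (- (1/2) - \<theta>/2)"
    unfolding rl by (simp add: mult.assoc)
qed

text \<open>
  Summation over the lags: \<open>s - q\<close> runs through distinct integers that are at least \<open>s - p\<close>.
\<close>
lemma inner_energy:
  assumes c: "\<And>q. q \<le> p \<Longrightarrow> \<bar>c q\<bar> \<le> u * real_of_int (s - q) powr (- (1/2) - \<theta>/2)" and "p < s"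
  shows "(\<Sum>q=lo..p. (c q)^2) \<le> u^2 * (1 + 1/\<theta>) * real_of_int (s - p) powr (- \<theta>)"
proof -
  have "(\<Sum>q=lo..p. (c q)^2) \<le> (\<Sum>q=lo..p. u^2 * real_of_int (s - q) powr (- 1 - \<theta>))"
  proof (rule sum_mono)
    fix q assume q: "q \<in> {lo..p}"
    have "\<bar>c q\<bar>^2 \<le> (u * real_of_int (s - q) powr (- (1/2) - \<theta>/2))^2"
      using c q by (intro power_mono) auto
    also have "\<dots> = u^2 * real_of_int (s - q) powr (- 1 - \<theta>)"
      by (simp add: power_mult_distrib powr_square)
    finally show "(c q)^2 \<le> u^2 * real_of_int (s - q) powr (- 1 - \<theta>)" by simp
  qed
  also have "\<dots> = u^2 * (\<Sum>q=lo..p. real_of_int (s - q) powr (- 1 - \<theta>))"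
    by (simp add: sum_distrib_left)
  also have "(\<Sum>q=lo..p. real_of_int (s - q) powr (- 1 - \<theta>)) = (\<Sum>j=nat (s - p)..nat (s - lo). real j powr (- 1 - \<theta>))"
    using assms(2) by (intro sum.reindex_bij_witness[of _ "\<lambda>j. s - int j" "\<lambda>q. nat (s - q)"]) auto
  also have "\<dots> \<le> (1 + 1/\<theta>) * real (nat (s - p)) powr (- \<theta>)"
    using assms(2) by (intro sum_powr_tail_le \<theta>) auto
  finally show ?thesis
    using assms(2) by (simp add: mult.assoc mult_left_mono)
qed

text \<open>
  The outer sum is split at \<open>m\<close> and at \<open>m - n\<close>. In the first two ranges the distance \<open>r\<close> runs through
  \<open>1, \<dots>, n\<close> and the terms are of order \<open>r powr (-\<theta>)\<close>; in the last one \<open>r > n\<close> and the terms are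
  of order \<open>n\<^sup>2 * r powr (-2 - 2 * \<theta>)\<close>.
\<close>
lemma residual_energy_le:
  "(\<Sum>p=lo..int (m + n). \<Sum>q=lo..p. (residual_coef f m n p q)^2) \<le> energy_const \<theta> * W^2 * real n powr (1 - \<theta>)"
proof (cases "n = 0")
  case True
  have "residual_coef f m 0 p q = 0" if "p \<le> int m" for p q
    using that by (auto simp: residual_coef_def)
  then show ?thesis using True by simp
next
  case False
  define D where "D = 1 + 2/\<theta>"
  define H where "H = 1 + 1/\<theta>"
  have D0: "0 \<le> D" "0 \<le> H" using \<theta> by (auto simp: D_def H_def)
  define I where "I = (\<lambda>p. \<Sum>q=lo..p. (residual_coef f m n p q)^2)"
  have I0: "0 \<le> I p" for p by (simp add: I_def sum_nonneg)
  have I_in: "I p \<le> (W * D)^2 * H * real_of_int (int (m + n) + 1 - p) powr (- \<theta>)" if "int m < p" "p \<le> int (m + n)" for p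
    unfolding I_def H_def D_def by (rule inner_energy) (use residual_coef_inside[of m p n] that in auto)
  have I_b1: "I p \<le> (W * D)^2 * H * real_of_int (int m + 1 - p) powr (- \<theta>)" if "p \<le> int m" for p
    unfolding I_def H_def D_def by (rule inner_energy) (use residual_coef_before(1)[of p m] that in auto)
  have I_b2: "I p \<le> W^2 * H * (real n ^ 2 * real_of_int (int m + 1 - p) powr (- 1 - (1 + 2 * \<theta>)))" if "p \<le> int m" for p
  proof -
    let ?r = "real_of_int (int m + 1 - p)"
    have "I p \<le> (W * (real n * ?r powr (- 1 - \<theta>/2)))^2 * H * ?r powr (- \<theta>)"
      unfolding I_def H_def by (rule inner_energy) (use residual_coef_before(2)[of p m] that in auto)
    also have "\<dots> = W^2 * H * (real n ^ 2 * ((?r powr (- 1 - \<theta>/2)) ^ 2 * ?r powr (- \<theta>)))"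
      by (simp add: power_mult_distrib)
    also have "(?r powr (- 1 - \<theta>/2)) ^ 2 * ?r powr (- \<theta>) = ?r powr (- 1 - (1 + 2 * \<theta>))"
      by (simp add: powr_square algebra_simps flip: powr_add)
    finally show ?thesis .
  qed
  have init: "(\<Sum>r=1..n. (W * D)^2 * H * real r powr (- \<theta>)) \<le> (W * D)^2 * H * (real n powr (1 - \<theta>) / (1 - \<theta>))"
    unfolding sum_distrib_left[symmetric] using D0 by (intro mult_left_mono sum_powr_initial_le \<theta>) auto
  have part1: "(\<Sum>p=int m + 1..int (m + n). I p) \<le> (W * D)^2 * H * (real n powr (1 - \<theta>) / (1 - \<theta>))"
  proof -
    have "(\<Sum>p=int m + 1..int (m + n). I p) \<le> (\<Sum>p=int m + 1..int (m + n). (W * D)^2 * H * real_of_int (int (m + n) + 1 - p) powr (- \<theta>))"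
      by (intro sum_mono I_in) auto
    also have "\<dots> = (\<Sum>r=1..n. (W * D)^2 * H * real r powr (- \<theta>))"
      by (rule sum.reindex_bij_witness[of _ "\<lambda>r. int (m + n) + 1 - int r" "\<lambda>p. nat (int (m + n) + 1 - p)"]) auto
    finally show ?thesis using init by linarith
  qed
  have part2: "(\<Sum>p=int m + 1 - int n..int m. I p) \<le> (W * D)^2 * H * (real n powr (1 - \<theta>) / (1 - \<theta>))"
  proof -
    have "(\<Sum>p=int m + 1 - int n..int m. I p) \<le> (\<Sum>p=int m + 1 - int n..int m. (W * D)^2 * H * real_of_int (int m + 1 - p) powr (- \<theta>))"
      by (intro sum_mono I_b1) auto
    also have "\<dots> = (\<Sum>r=1..n. (W * D)^2 * H * real r powr (- \<theta>))"
      by (rule sum.reindex_bij_witness[of _ "\<lambda>r. int m + 1 - int r" "\<lambda>p. nat (int m + 1 - p)"]) auto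
    finally show ?thesis using init by linarith
  qed
  have part3: "(\<Sum>p=lo..int m - int n. I p) \<le> W^2 * H * (2 * real n powr (1 - \<theta>))"
  proof -
    let ?x = "1 + 2 * \<theta>"
    have "(\<Sum>p=lo..int m - int n. I p) \<le> (\<Sum>p=lo..int m - int n. W^2 * H * (real n ^ 2 * real_of_int (int m + 1 - p) powr (- 1 - ?x)))"
      by (intro sum_mono I_b2) auto
    also have "\<dots> = (\<Sum>r=n+1..nat (int m + 1 - lo). W^2 * H * (real n ^ 2 * real r powr (- 1 - ?x)))"
      by (rule sum.reindex_bij_witness[of _ "\<lambda>r. int m + 1 - int r" "\<lambda>p. nat (int m + 1 - p)"]) auto
    also have "\<dots> = W^2 * H * (real n ^ 2 * (\<Sum>r=n+1..nat (int m + 1 - lo). real r powr (- 1 - ?x)))"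
      by (simp add: sum_distrib_left)
    also have "\<dots> \<le> W^2 * H * (real n ^ 2 * ((1 + 1 / ?x) * real (n + 1) powr (- ?x)))"
      using \<theta> D0 by (intro mult_left_mono sum_powr_tail_le) auto
    also have "\<dots> \<le> W^2 * H * (real n ^ 2 * (2 * real n powr (- ?x)))"
      using \<theta> D0 False by (intro mult_left_mono mult_mono powr_mono2') auto
    also have "real n ^ 2 * (2 * real n powr (- ?x)) = 2 * real n powr (2 + - ?x)"
      using False unfolding powr_add by simp
    also have "W^2 * H * (2 * real n powr (2 + - ?x)) \<le> W^2 * H * (2 * real n powr (1 - \<theta>))"
      using \<theta> D0 False by (intro mult_left_mono powr_mono) auto
    finally show ?thesis .
  qed
  have "(\<Sum>p=lo..int (m + n). I p) \<le> (\<Sum>p\<in>{int m + 1..int (m + n)} \<union> ({int m + 1 - int n..int m} \<union> {lo..int m - int n}). I p)"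
    by (rule sum_mono2) (auto simp: I0)
  also have "\<dots> = (\<Sum>p=int m + 1..int (m + n). I p) + ((\<Sum>p=int m + 1 - int n..int m. I p) + (\<Sum>p=lo..int m - int n. I p))"
    by (subst sum.union_disjoint; (subst sum.union_disjoint)?; auto)
  also have "\<dots> \<le> (W * D)^2 * H * (real n powr (1 - \<theta>) / (1 - \<theta>)) + ((W * D)^2 * H * (real n powr (1 - \<theta>) / (1 - \<theta>)) + W^2 * H * (2 * real n powr (1 - \<theta>)))"
    by (intro add_mono part1 part2 part3)
  also have "\<dots> = energy_const \<theta> * W^2 * real n powr (1 - \<theta>)"
    unfolding energy_const_def D_def[symmetric] H_def[symmetric] using \<theta>
    by (simp add: power_mult_distrib algebra_simps add_divide_distrib)
  finally show ?thesis unfolding I_def .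
qed

text \<open>
  Square summability of the coefficients of the inner series of the martingale; it makes that series
  converge almost surely. The term \<open>j = 0\<close> is split off because the tail bound starts at \<open>r = 1\<close>.
\<close>
lemma summable_square_suminf: "summable (\<lambda>l. (\<Sum>j. f (Suc l) j)^2)"
proof (rule summable_comparison_test')
  have "summable (\<lambda>l. real l powr (- 1 - \<theta>))"
    using \<theta> by (simp add: summable_real_powr_iff)
  then have "summable (\<lambda>l. real (Suc l) powr (- 1 - \<theta>))"
    by (subst summable_Suc_iff)
  then show "summable (\<lambda>l. (W * (2 + 2/\<theta>))^2 * real (Suc l) powr (- 1 - \<theta>))"
    by (rule summable_mult)
next
  fix l
  let ?l = "Suc l" and ?\<kappa> = "- (1/2) - \<theta>/2"
  let ?d = "\<lambda>j. decay \<theta> j * decay \<theta> (j + ?l)"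
  note s = summable_decay_product[OF \<theta>(1), of ?l]
  have "\<bar>\<Sum>j. f ?l j\<bar> \<le> (\<Sum>j. W * ?d j)"
    using norm_suminf_le[OF _ summable_mult[OF s, of W], of "f ?l"] f_le[of ?l] by simp
  also have "\<dots> = W * (\<Sum>j. ?d j)"
    by (rule suminf_mult[OF s])
  also have "(\<Sum>j. ?d j) = decay \<theta> 0 * decay \<theta> ?l + (\<Sum>j. decay \<theta> (1 + j) * decay \<theta> (1 + j + ?l))"
    using suminf_split_head[OF s] by simp
  also have "decay \<theta> 0 * decay \<theta> ?l = real ?l powr (- (3/4) - \<theta>/2)"
    by (simp add: decay_def)
  also have "real ?l powr (- (3/4) - \<theta>/2) \<le> real ?l powr ?\<kappa>"
    by (intro powr_mono) auto
  also have "(\<Sum>j. decay \<theta> (1 + j) * decay \<theta> (1 + j + ?l)) \<le> (1 + 2/\<theta>) * real (1 + ?l) powr ?\<kappa>"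
    by (rule decay_product_tail_le[OF \<theta>(1)]) simp
  also have "\<dots> \<le> (1 + 2/\<theta>) * real ?l powr ?\<kappa>"
    using \<theta> by (intro mult_left_mono powr_mono2') auto
  also have "W * (real ?l powr ?\<kappa> + (1 + 2/\<theta>) * real ?l powr ?\<kappa>) = W * (2 + 2/\<theta>) * real ?l powr ?\<kappa>"
    by (simp add: algebra_simps)
  finally have "\<bar>\<Sum>j. f ?l j\<bar> \<le> W * (2 + 2/\<theta>) * real ?l powr ?\<kappa>"
    using decay_bound_nonneg by (simp add: mult_left_mono)
  then have "\<bar>\<Sum>j. f ?l j\<bar>^2 \<le> (W * (2 + 2/\<theta>) * real ?l powr ?\<kappa>)^2"
    by (intro power_mono) auto
  also have "\<dots> = (W * (2 + 2/\<theta>))^2 * real ?l powr (- 1 - \<theta>)"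
    by (simp add: power_mult_distrib powr_square)
  finally show "norm ((\<Sum>j. f ?l j)^2) \<le> (W * (2 + 2/\<theta>))^2 * real ?l powr (- 1 - \<theta>)"
    by simp
qed

end

section \<open>The residual for one row\<close>

text \<open>
  Turns a product of two linear forms into a sum over ordered pairs, in which each product of two
  different innovations occurs once.
\<close>
lemma sum_square_triangle:
  fixes \<phi> :: "'i::linorder \<Rightarrow> 'i \<Rightarrow> 'b::comm_monoid_add"
  assumes "finite P"
  shows "(\<Sum>p\<in>P. \<Sum>q\<in>P. \<phi> p q) = (\<Sum>p\<in>P. \<phi> p p + (\<Sum>q\<in>{q\<in>P. q < p}. \<phi> p q + \<phi> q p))"
  using assms
proof (induction rule: finite_linorder_max_induct)
  case (insert b A)
  have b: "b \<notin> A" using insert by auto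
  have sub: "{q. (q = b \<or> q \<in> A) \<and> q < p} = {q\<in>A. q < p}" if "p \<in> A" for p
    using that insert by auto
  have sub2: "{q. (q = b \<or> q \<in> A) \<and> q < b} = A"
    using insert by auto
  have "(\<Sum>p\<in>insert b A. \<Sum>q\<in>insert b A. \<phi> p q) =
     (\<phi> b b + (\<Sum>q\<in>A. \<phi> b q + \<phi> q b)) + (\<Sum>p\<in>A. \<Sum>q\<in>A. \<phi> p q)"
    using insert(1) b by (simp add: sum.distrib ac_simps)
  then show ?case
    using insert(1,3) b by (simp add: sub sub2 cong: sum.cong)
qed simp

text \<open>
  Used to extract one row from a doubly indexed independent family.
\<close>
lemma (in prob_space) indep_vars_reindex_inj:
  assumes ind: "indep_vars M' Z I" and h: "inj_on h J" "h ` J \<subseteq> I"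
  shows "indep_vars (\<lambda>j. M' (h j)) (\<lambda>j. Z (h j)) J"
  unfolding indep_vars_def2
proof (intro conjI ballI indep_setsI)
  have rv: "\<And>i. i \<in> I \<Longrightarrow> random_variable (M' i) (Z i)"
    and sets: "indep_sets (\<lambda>i. {Z i -` A \<inter> space M | A. A \<in> sets (M' i)}) I"
    using ind by (auto simp: indep_vars_def2)
  show rvJ: "random_variable (M' (h j)) (Z (h j))" if "j \<in> J" for j using rv that h(2) by blast
  show "{Z (h j) -` A \<inter> space M | A. A \<in> sets (M' (h j))} \<subseteq> events" if "j \<in> J" for j
    using measurable_sets[OF rvJ[OF that]] by blast
  fix A L assume L: "L \<noteq> {}" "L \<subseteq> J" "finite L"
    and A: "\<forall>j\<in>L. A j \<in> {Z (h j) -` A \<inter> space M | A. A \<in> sets (M' (h j))}"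
  define g where "g = inv_into L h"
  have injL: "inj_on h L" using h(1) L(2) by (rule inj_on_subset)
  have g: "g (h j) = j" if "j \<in> L" for j
    unfolding g_def using injL that by (rule inv_into_f_f)
  have "prob (\<Inter>i\<in>h ` L. A (g i)) = (\<Prod>i\<in>h ` L. prob (A (g i)))"
  proof (rule indep_setsD[OF sets])
    show "h ` L \<subseteq> I" "h ` L \<noteq> {}" "finite (h ` L)" using L h(2) by auto
    show "\<forall>i\<in>h ` L. A (g i) \<in> {Z i -` A \<inter> space M | A. A \<in> sets (M' i)}"
    proof
      fix i assume "i \<in> h ` L"
      then obtain j where "j \<in> L" "i = h j" by blast
      then show "A (g i) \<in> {Z i -` A \<inter> space M | A. A \<in> sets (M' i)}"
        using bspec[OF A, of j] by (simp only: g)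
    qed
  qed
  moreover have "(\<Inter>i\<in>h ` L. A (g i)) = (\<Inter>j\<in>L. A j)" using g by simp
  moreover have "(\<Prod>i\<in>h ` L. prob (A (g i))) = (\<Prod>j\<in>L. prob (A j))"
    using g by (subst prod.reindex[OF injL]) simp
  ultimately show "prob (\<Inter>j\<in>L. A j) = (\<Prod>j\<in>L. prob (A j))" by (simp only:)
qed

definition cross_coef :: "(nat \<Rightarrow> real) \<Rightarrow> (nat \<Rightarrow> real) \<Rightarrow> nat \<Rightarrow> nat \<Rightarrow> real" where
  "cross_coef \<alpha> \<beta> l j = (if l = 0 then \<alpha> j * \<beta> j else \<alpha> j * \<beta> (j + l) + \<beta> j * \<alpha> (j + l))"

lemma cross_coef_le:
  assumes \<alpha>: "\<And>j. \<bar>\<alpha> j\<bar> \<le> A * decay \<theta> j" and \<beta>: "\<And>j. \<bar>\<beta> j\<bar> \<le> B * decay \<theta> j"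
  shows "\<bar>cross_coef \<alpha> \<beta> l j\<bar> \<le> 2 * A * B * (decay \<theta> j * decay \<theta> (j + l))"
proof -
  have *: "\<bar>\<alpha> i * \<beta> j\<bar> \<le> A * B * (decay \<theta> i * decay \<theta> j)" for i j
  proof -
    have "\<bar>\<alpha> i\<bar> * \<bar>\<beta> j\<bar> \<le> (A * decay \<theta> i) * (B * decay \<theta> j)"
      using order_trans[OF abs_ge_zero \<alpha>] by (intro mult_mono \<alpha> \<beta>) auto
    then show ?thesis by (simp add: abs_mult mult_ac)
  qed
  show ?thesis
  proof (cases "l = 0")
    case True
    then show ?thesis using *[of j j] order_trans[OF abs_ge_zero *[of j j]] by (simp add: cross_coef_def)
  next
    case False
    then show ?thesis using *[of j "j + l"] *[of "j + l" j] abs_triangle_ineq[of "\<alpha> j * \<beta> (j + l)" "\<alpha> (j + l) * \<beta> j"]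
      by (simp add: cross_coef_def mult_ac)
  qed
qed

context indep_innovations
begin

text \<open>
  The orthogonal variables in which the partial sums and the martingale are expanded.
\<close>
definition \<eta> :: "int \<Rightarrow> int \<Rightarrow> 'a \<Rightarrow> real" where
  "\<eta> p q \<omega> = X p \<omega> * X q \<omega> - (if p = q then \<sigma>2 p else 0)"

lemma \<eta>_measurable [measurable]: "\<eta> p q \<in> borel_measurable M"
  unfolding \<eta>_def by measurable

lemma quadratic_form_interval:
  "(\<integral>\<^sup>+\<omega>. ennreal ((\<Sum>p=lo..hi. \<Sum>q=lo..p. c p q * \<eta> p q \<omega>)^2) \<partial>M) \<le>
     ennreal (2 * K^2 * (\<Sum>p=lo..hi. \<Sum>q=lo..p. (c p q)^2))"
proof -
  have le: "{q\<in>{lo..hi}. q \<le> p} = {lo..p}" "{q\<in>{lo..hi}. q < p} = {lo..p} - {p}" if "p \<in> {lo..hi}" for p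
    using that by auto
  have eq: "(\<Sum>p=lo..hi. \<Sum>q=lo..p. c p q * \<eta> p q \<omega>) =
    (\<Sum>p\<in>{lo..hi}. c p p * (X p \<omega> ^ 2 - \<sigma>2 p) + (\<Sum>q\<in>{q\<in>{lo..hi}. q < p}. c p q * X q \<omega>) * X p \<omega>)" for \<omega>
  proof (rule sum.cong[OF refl])
    fix p assume p: "p \<in> {lo..hi}"
    then have "(\<Sum>q=lo..p. c p q * \<eta> p q \<omega>) = c p p * \<eta> p p \<omega> + (\<Sum>q\<in>{lo..p} - {p}. c p q * \<eta> p q \<omega>)"
      by (intro sum.remove) auto
    also have "(\<Sum>q\<in>{lo..p} - {p}. c p q * \<eta> p q \<omega>) = (\<Sum>q\<in>{lo..p} - {p}. c p q * X q \<omega>) * X p \<omega>"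
      unfolding sum_distrib_right by (intro sum.cong refl) (auto simp: \<eta>_def)
    finally show "(\<Sum>q=lo..p. c p q * \<eta> p q \<omega>) =
      c p p * (X p \<omega> ^ 2 - \<sigma>2 p) + (\<Sum>q\<in>{q\<in>{lo..hi}. q < p}. c p q * X q \<omega>) * X p \<omega>"
      using le(2)[OF p] by (simp add: \<eta>_def power2_eq_square)
  qed
  have eq2: "(\<Sum>p=lo..hi. \<Sum>q=lo..p. (c p q)^2) = (\<Sum>p\<in>{lo..hi}. \<Sum>q\<in>{q\<in>{lo..hi}. q \<le> p}. (c p q)^2)"
    by (intro sum.cong refl) (use le in auto)
  note Q = quadratic_form_square[of "{lo..hi}" c]
  show ?thesis
    unfolding eq eq2 using Q by (subst nn_integral_eq_integral) (auto intro: ennreal_leI)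
qed

definition lin :: "(nat \<Rightarrow> real) \<Rightarrow> int \<Rightarrow> 'a \<Rightarrow> real" where
  "lin \<alpha> i \<omega> = (\<Sum>j. \<alpha> j * X (i - int j) \<omega>)"

text \<open>
  The linear process without the innovations of index below \<open>lo\<close>, written as a sum over innovations
  so that processes at different times \<open>i\<close> can be combined.
\<close>
definition lin_cut :: "int \<Rightarrow> (nat \<Rightarrow> real) \<Rightarrow> int \<Rightarrow> 'a \<Rightarrow> real" where
  "lin_cut lo \<alpha> i \<omega> = (\<Sum>p=lo..i. \<alpha> (nat (i - p)) * X p \<omega>)"

lemma lin_cut_product:
  "lin_cut lo \<alpha> i \<omega> * lin_cut lo \<beta> i \<omega> - (\<Sum>p=lo..i. \<alpha> (nat (i - p)) * \<beta> (nat (i - p)) * \<sigma>2 p)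
    = (\<Sum>p=lo..i. \<Sum>q=lo..p. cross_coef \<alpha> \<beta> (nat (p - q)) (nat (i - p)) * \<eta> p q \<omega>)"
proof -
  let ?\<phi> = "\<lambda>p q. \<alpha> (nat (i - p)) * \<beta> (nat (i - q)) * (X p \<omega> * X q \<omega>)"
  have "lin_cut lo \<alpha> i \<omega> * lin_cut lo \<beta> i \<omega> = (\<Sum>p=lo..i. \<Sum>q=lo..i. ?\<phi> p q)"
    by (simp add: lin_cut_def sum_product mult_ac)
  also have "\<dots> = (\<Sum>p=lo..i. ?\<phi> p p + (\<Sum>q\<in>{q\<in>{lo..i}. q < p}. ?\<phi> p q + ?\<phi> q p))"
    by (rule sum_square_triangle) simp
  finally have "lin_cut lo \<alpha> i \<omega> * lin_cut lo \<beta> i \<omega> - (\<Sum>p=lo..i. \<alpha> (nat (i - p)) * \<beta> (nat (i - p)) * \<sigma>2 p)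
     = (\<Sum>p=lo..i. ?\<phi> p p - \<alpha> (nat (i - p)) * \<beta> (nat (i - p)) * \<sigma>2 p + (\<Sum>q\<in>{q\<in>{lo..i}. q < p}. ?\<phi> p q + ?\<phi> q p))"
    by (simp add: sum.distrib sum_subtractf)
  also have "\<dots> = (\<Sum>p=lo..i. \<Sum>q=lo..p. cross_coef \<alpha> \<beta> (nat (p - q)) (nat (i - p)) * \<eta> p q \<omega>)"
  proof (rule sum.cong[OF refl])
    fix p assume p: "p \<in> {lo..i}"
    let ?t = "\<lambda>q. cross_coef \<alpha> \<beta> (nat (p - q)) (nat (i - p)) * \<eta> p q \<omega>"
    have set: "{q\<in>{lo..i}. q < p} = {lo..p} - {p}" using p by auto
    have "(\<Sum>q=lo..p. ?t q) = ?t p + (\<Sum>q\<in>{lo..p} - {p}. ?t q)"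
      using p by (intro sum.remove) auto
    also have "?t p = ?\<phi> p p - \<alpha> (nat (i - p)) * \<beta> (nat (i - p)) * \<sigma>2 p"
      by (simp add: cross_coef_def \<eta>_def algebra_simps)
    also have "(\<Sum>q\<in>{lo..p} - {p}. ?t q) = (\<Sum>q\<in>{lo..p} - {p}. ?\<phi> p q + ?\<phi> q p)"
    proof (rule sum.cong[OF refl])
      fix q assume q: "q \<in> {lo..p} - {p}"
      have n: "nat (i - p) + nat (p - q) = nat (i - q)" "nat (p - q) \<noteq> 0" "p \<noteq> q" using p q by auto
      show "?t q = ?\<phi> p q + ?\<phi> q p"
        using n(2,3) by (simp add: cross_coef_def \<eta>_def n(1) algebra_simps)
    qed
    finally show "?\<phi> p p - \<alpha> (nat (i - p)) * \<beta> (nat (i - p)) * \<sigma>2 p + (\<Sum>q\<in>{q\<in>{lo..i}. q < p}. ?\<phi> p q + ?\<phi> q p) = (\<Sum>q=lo..p. ?t q)"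
      unfolding set by simp
  qed
  finally show ?thesis .
qed

lemma martingale_increment_cut:
  assumes "lo \<le> i"
  shows "F 0 * (X i \<omega> ^ 2 - \<sigma>2 i) + X i \<omega> * (\<Sum>q=lo..<i. F (nat (i - q)) * X q \<omega>)
     = (\<Sum>q=lo..i. F (nat (i - q)) * \<eta> i q \<omega>)"
proof -
  have "{lo..i} = insert i {lo..<i}" using assms by auto
  then have "(\<Sum>q=lo..i. F (nat (i - q)) * \<eta> i q \<omega>) = F 0 * \<eta> i i \<omega> + (\<Sum>q=lo..<i. F (nat (i - q)) * \<eta> i q \<omega>)"
    by simp
  also have "(\<Sum>q=lo..<i. F (nat (i - q)) * \<eta> i q \<omega>) = X i \<omega> * (\<Sum>q=lo..<i. F (nat (i - q)) * X q \<omega>)"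
    unfolding sum_distrib_left by (intro sum.cong refl) (auto simp: \<eta>_def)
  finally show ?thesis by (simp add: \<eta>_def power2_eq_square)
qed

text \<open>
  The first triple sum is the centred partial sum and the second sum the martingale increment, both
  without the innovations below \<open>lo\<close>. Collecting the terms with the same \<open>\<eta> p q\<close> gives the difference as
  one form. As \<open>lo \<le> 0\<close>, every time \<open>i\<close> of the window is itself an admissible index.
\<close>
lemma residual_quadratic_form:
  fixes lo :: int and m n :: nat and f :: "nat \<Rightarrow> nat \<Rightarrow> real"
  assumes lo: "lo \<le> 0"
  shows "(\<Sum>i=m+1..m+n. \<Sum>p=lo..int i. \<Sum>q=lo..p. f (nat (p - q)) (nat (int i - p)) * \<eta> p q \<omega>)
     - (\<Sum>i=m+1..m+n. \<Sum>q=lo..int i. suminf (f (nat (int i - q))) * \<eta> (int i) q \<omega>)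
     = (\<Sum>p=lo..int (m + n). \<Sum>q=lo..p. residual_coef f m n p q * \<eta> p q \<omega>)"
proof -
  let ?N = "int (m + n)"
  let ?g = "\<lambda>i p. \<Sum>q=lo..p. f (nat (p - q)) (nat (int i - p)) * \<eta> p q \<omega>"
  let ?h = "\<lambda>p. \<Sum>q=lo..p. suminf (f (nat (p - q))) * \<eta> p q \<omega>"
  have "(\<Sum>i=m+1..m+n. \<Sum>p=lo..int i. ?g i p) = (\<Sum>i=m+1..m+n. \<Sum>p\<in>{p\<in>{lo..?N}. p \<le> int i}. ?g i p)"
    by (intro sum.cong refl) auto
  also have "\<dots> = (\<Sum>p=lo..?N. \<Sum>i\<in>{i\<in>{m+1..m+n}. p \<le> int i}. ?g i p)"
    by (rule sum.swap_restrict) auto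
  also have "\<dots> = (\<Sum>p=lo..?N. \<Sum>q=lo..p. (\<Sum>i\<in>{i\<in>{m+1..m+n}. p \<le> int i}. f (nat (p - q)) (nat (int i - p))) * \<eta> p q \<omega>)"
    by (intro sum.cong refl) (subst sum.swap, simp add: sum_distrib_right)
  finally have 1: "(\<Sum>i=m+1..m+n. \<Sum>p=lo..int i. ?g i p) = \<dots>" .
  have "(\<Sum>i=m+1..m+n. ?h (int i)) = (\<Sum>p\<in>{p\<in>{lo..?N}. int m < p}. ?h p)"
    using lo by (intro sum.reindex_bij_witness[of _ nat int]) auto
  also have "\<dots> = (\<Sum>p=lo..?N. if int m < p then ?h p else 0)"
    by (rule sum.inter_filter) simp
  also have "\<dots> = (\<Sum>p=lo..?N. \<Sum>q=lo..p. (if int m < p then suminf (f (nat (p - q))) else 0) * \<eta> p q \<omega>)"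
    by (intro sum.cong refl) auto
  finally have 2: "(\<Sum>i=m+1..m+n. ?h (int i)) = \<dots>" .
  show ?thesis
    unfolding 1 2 residual_coef_def left_diff_distrib sum_subtractf by simp
qed

text \<open>
  The statement for one row and arbitrary coefficient sequences. The residuals of the processes cut at
  \<open>-J\<close> are quadratic forms whose mean squares are bounded independently of \<open>J\<close>, and they converge
  almost surely to the residual.
\<close>
theorem mean_square_residual:
  assumes \<theta>: "0 < \<theta>" "\<theta> < 1"
    and \<alpha>: "\<And>j. \<bar>\<alpha> j\<bar> \<le> A * decay \<theta> j" and \<beta>: "\<And>j. \<bar>\<beta> j\<bar> \<le> B * decay \<theta> j"
  defines "F \<equiv> \<lambda>l. suminf (cross_coef \<alpha> \<beta> l)"
  shows "(\<integral>\<^sup>+\<omega>. ennreal (((\<Sum>i=m+1..m+n. lin \<alpha> (int i) \<omega> * lin \<beta> (int i) \<omega>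
              - expectation (\<lambda>\<omega>'. lin \<alpha> (int i) \<omega>' * lin \<beta> (int i) \<omega>'))
          - (\<Sum>i=m+1..m+n. F 0 * (X (int i) \<omega> ^ 2 - \<sigma>2 (int i))
              + X (int i) \<omega> * (\<Sum>l. F (Suc l) * X (int i - int (Suc l)) \<omega>)))^2) \<partial>M)
     \<le> ennreal (2 * K^2 * (energy_const \<theta> * (2 * A * B)^2 * real n powr (1 - \<theta>)))"
proof -
  let ?f = "cross_coef \<alpha> \<beta>"
  note f_le = cross_coef_le[of \<alpha> A \<theta> \<beta> B, OF \<alpha> \<beta>]
  note \<alpha>2 = summable_square_of_decay[of \<theta> \<alpha> A, OF \<theta>(1) \<alpha>]
    and \<beta>2 = summable_square_of_decay[of \<theta> \<beta> B, OF \<theta>(1) \<beta>]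
  have F2: "summable (\<lambda>l. F (Suc l) ^ 2)"
    unfolding F_def by (rule summable_square_suminf[OF \<theta> f_le])
  \<comment> \<open>Re-indexed by the lag, the cut sums are initial segments of the series that define the
      processes, of lengths \<open>J + i + 1\<close> and \<open>J + i\<close>.\<close>
  have lin_cut_eq: "lin_cut (- int J) \<gamma> (int i) \<omega> = (\<Sum>j<J + (i + 1). \<gamma> j * X (int i - int j) \<omega>)" for \<gamma> i J \<omega>
    unfolding lin_cut_def
    by (rule sum.reindex_bij_witness[of _ "\<lambda>j. int i - int j" "\<lambda>p. nat (int i - p)"]) auto
  have mart_cut_eq: "(\<Sum>q=- int J..<int i. F (nat (int i - q)) * X q \<omega>) = (\<Sum>l<J + i. F (Suc l) * X (int i - int (Suc l)) \<omega>)" for i J \<omega>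
    by (rule sum.reindex_bij_witness[of _ "\<lambda>l. int i - int (Suc l)" "\<lambda>q. nat (int i - q) - 1"])
       (auto simp: nat_diff_distrib)
  have center_cut_eq: "(\<Sum>p=- int J..int i. \<alpha> (nat (int i - p)) * \<beta> (nat (int i - p)) * \<sigma>2 p)
     = (\<Sum>j<J + (i + 1). \<alpha> j * \<beta> j * \<sigma>2 (int i - int j))" for i J
    by (rule sum.reindex_bij_witness[of _ "\<lambda>j. int i - int j" "\<lambda>p. nat (int i - p)"]) auto
  have residual_eq: "(\<Sum>p=- int J..int (m + n). \<Sum>q=- int J..p. residual_coef ?f m n p q * \<eta> p q \<omega>) =
     (\<Sum>i=m+1..m+n. lin_cut (- int J) \<alpha> (int i) \<omega> * lin_cut (- int J) \<beta> (int i) \<omega>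
         - (\<Sum>j<J + (i + 1). \<alpha> j * \<beta> j * \<sigma>2 (int i - int j)))
     - (\<Sum>i=m+1..m+n. F 0 * (X (int i) \<omega> ^ 2 - \<sigma>2 (int i)) + X (int i) \<omega> * (\<Sum>l<J + i. F (Suc l) * X (int i - int (Suc l)) \<omega>))" for J \<omega>
  proof -
    have "F 0 * (X (int i) \<omega> ^ 2 - \<sigma>2 (int i)) + X (int i) \<omega> * (\<Sum>l<J + i. F (Suc l) * X (int i - int (Suc l)) \<omega>)
       = (\<Sum>q=- int J..int i. suminf (?f (nat (int i - q))) * \<eta> (int i) q \<omega>)" for i
      unfolding mart_cut_eq[symmetric] using martingale_increment_cut[of "- int J" "int i" F \<omega>] by (simp add: F_def)
    moreover have "lin_cut (- int J) \<alpha> (int i) \<omega> * lin_cut (- int J) \<beta> (int i) \<omega>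
         - (\<Sum>j<J + (i + 1). \<alpha> j * \<beta> j * \<sigma>2 (int i - int j)) =
       (\<Sum>p=- int J..int i. \<Sum>q=- int J..p. ?f (nat (p - q)) (nat (int i - p)) * \<eta> p q \<omega>)" for i
      unfolding center_cut_eq[symmetric] by (rule lin_cut_product)
    ultimately show ?thesis
      using residual_quadratic_form[where lo = "- int J" and m = m and n = n and f = ?f and \<omega> = \<omega>] by simp
  qed
  have inj1: "inj (\<lambda>j. int i - int j)" and inj2: "inj (\<lambda>j. int i - int (Suc j))" for i
    by (auto simp: inj_def)
  have center: "(\<lambda>J. \<Sum>j<J + (i + 1). \<alpha> j * \<beta> j * \<sigma>2 (int i - int j)) \<longlonglongrightarrow>
      expectation (\<lambda>\<omega>'. lin \<alpha> (int i) \<omega>' * lin \<beta> (int i) \<omega>')" for i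
    using LIMSEQ_ignore_initial_segment[OF expectation_product_of_linear_forms[OF inj1[of i] \<alpha>2 \<beta>2], of "i + 1"]
    by (simp add: lin_def)
  have "AE \<omega> in M. \<forall>i. summable (\<lambda>j. \<alpha> j * X (int i - int j) \<omega>)"
    unfolding AE_all_countable using AE_summable_innovations[OF inj1 \<alpha>2] by simp
  moreover have "AE \<omega> in M. \<forall>i. summable (\<lambda>j. \<beta> j * X (int i - int j) \<omega>)"
    unfolding AE_all_countable using AE_summable_innovations[OF inj1 \<beta>2] by simp
  moreover have "AE \<omega> in M. \<forall>i. summable (\<lambda>l. F (Suc l) * X (int i - int (Suc l)) \<omega>)"
    unfolding AE_all_countable using AE_summable_innovations[OF inj2 F2] by simp
  ultimately have limit: "AE \<omega> in M. (\<lambda>J. \<Sum>p=- int J..int (m + n). \<Sum>q=- int J..p. residual_coef ?f m n p q * \<eta> p q \<omega>)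
     \<longlonglongrightarrow> (\<Sum>i=m+1..m+n. lin \<alpha> (int i) \<omega> * lin \<beta> (int i) \<omega>
              - expectation (\<lambda>\<omega>'. lin \<alpha> (int i) \<omega>' * lin \<beta> (int i) \<omega>'))
          - (\<Sum>i=m+1..m+n. F 0 * (X (int i) \<omega> ^ 2 - \<sigma>2 (int i))
              + X (int i) \<omega> * (\<Sum>l. F (Suc l) * X (int i - int (Suc l)) \<omega>))"
  proof eventually_elim
    case (elim \<omega>)
    have L: "(\<lambda>J. lin_cut (- int J) \<gamma> (int i) \<omega>) \<longlonglongrightarrow> lin \<gamma> (int i) \<omega>"
      if "summable (\<lambda>j. \<gamma> j * X (int i - int j) \<omega>)" for \<gamma> i
      unfolding lin_cut_eq lin_def by (rule LIMSEQ_ignore_initial_segment[OF summable_LIMSEQ[OF that]])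
    show ?case
      unfolding residual_eq using elim
      by (intro tendsto_intros tendsto_sum L center LIMSEQ_ignore_initial_segment[OF summable_LIMSEQ]) auto
  qed
  show ?thesis
  proof (rule fatou_square_bound[OF _ limit])
    fix J :: nat
    show "(\<integral>\<^sup>+\<omega>. ennreal ((\<Sum>p=- int J..int (m + n). \<Sum>q=- int J..p. residual_coef ?f m n p q * \<eta> p q \<omega>)^2) \<partial>M)
       \<le> ennreal (2 * K^2 * (energy_const \<theta> * (2 * A * B)^2 * real n powr (1 - \<theta>)))"
      by (rule order_trans[OF quadratic_form_interval])
         (intro ennreal_leI mult_left_mono residual_energy_le[OF \<theta> f_le], simp)
  qed measurable
qed

end

section \<open>Weighted arrays\<close>

text \<open>
  For \<open>r \<le> 4\<close> and \<open>x \<ge> 0\<close>, \<open>x ^ r \<le> 1 + x powr (4 + \<delta>)\<close>, so \<open>K\<close> can be one plus the supremum of the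
  moments of order \<open>4 + \<delta>\<close>.
\<close>
lemma uniform_innovations:
  fixes \<epsilon> :: "nat \<Rightarrow> int \<Rightarrow> 'a \<Rightarrow> real"
  assumes "prob_space M" and E: "assumption_E M \<theta> \<epsilon>"
  obtains K where "\<And>n. 1 \<le> n \<Longrightarrow> indep_innovations M (\<epsilon> n) K"
proof -
  interpret prob_space M by fact
  have ind: "indep_vars (\<lambda>_. borel) (\<lambda>(n, k). \<epsilon> n k) ({1..} \<times> UNIV)"
    and mean: "\<And>n k. 1 \<le> n \<Longrightarrow> expectation (\<epsilon> n k) = 0"
    using E by (auto simp: assumption_E_def)
  obtain \<delta> where \<delta>: "0 < \<delta>"
    and fin: "(SUP n\<in>{1..}. (SUP k. (\<integral>\<^sup>+\<omega>. ennreal (\<bar>\<epsilon> n k \<omega>\<bar> powr (4 + \<delta>)) \<partial>M))) < \<infinity>"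
    using E unfolding assumption_E_def by blast
  define S where "S = (SUP n\<in>{1..}. (SUP k. (\<integral>\<^sup>+\<omega>. ennreal (\<bar>\<epsilon> n k \<omega>\<bar> powr (4 + \<delta>)) \<partial>M)))"
  have S: "S < \<infinity>" using fin by (simp add: S_def)
  define K where "K = 1 + enn2real S"
  have K: "ennreal K = 1 + S" using S by (simp add: K_def ennreal_plus)
  have "indep_innovations M (\<epsilon> n) K" if n: "1 \<le> n" for n
  proof -
    have indn: "indep_vars (\<lambda>_. borel) (\<epsilon> n) UNIV"
      using indep_vars_reindex_inj[OF ind, of "\<lambda>k. (n, k)" UNIV] n by (simp add: inj_on_def image_subset_iff)
    then have [measurable]: "\<epsilon> n k \<in> borel_measurable M" for k by (simp add: indep_vars_def)
    have mom: "(\<integral>\<^sup>+\<omega>. ennreal (\<bar>\<epsilon> n k \<omega>\<bar> powr (4 + \<delta>)) \<partial>M) \<le> S" for k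
      unfolding S_def using n by (intro SUP_upper2[of n] SUP_upper) auto
    have pw: "x ^ r \<le> 1 + x powr (4 + \<delta>)" if "0 \<le> x" "r \<le> 4" for x :: real and r :: nat
    proof (cases "x \<le> 1")
      case True
      then have "x ^ r \<le> 1" using that by (simp add: power_le_one)
      then show ?thesis by (simp add: add_increasing2)
    next
      case False
      then have "x ^ r = x powr real r" by (simp add: powr_realpow)
      also have "\<dots> \<le> x powr (4 + \<delta>)" using False that \<delta> by (intro powr_mono) auto
      finally show ?thesis by simp
    qed
    have le: "(\<integral>\<^sup>+\<omega>. ennreal (\<bar>\<epsilon> n k \<omega>\<bar> ^ r) \<partial>M) \<le> ennreal K" if "r \<le> 4" for k r
    proof -
      have "(\<integral>\<^sup>+\<omega>. ennreal (\<bar>\<epsilon> n k \<omega>\<bar> ^ r) \<partial>M) \<le> (\<integral>\<^sup>+\<omega>. 1 + ennreal (\<bar>\<epsilon> n k \<omega>\<bar> powr (4 + \<delta>)) \<partial>M)"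
        using pw[OF abs_ge_zero that] by (intro nn_integral_mono) (simp flip: ennreal_plus ennreal_1 add: ennreal_leI)
      also have "\<dots> = 1 + (\<integral>\<^sup>+\<omega>. ennreal (\<bar>\<epsilon> n k \<omega>\<bar> powr (4 + \<delta>)) \<partial>M)"
        by (subst nn_integral_add) (auto simp: emeasure_space_1)
      also have "\<dots> \<le> 1 + S" by (intro add_left_mono mom)
      finally show ?thesis by (simp add: K)
    qed
    have K1: "1 \<le> K" by (simp add: K_def)
    have *: "integrable M (\<lambda>\<omega>. \<epsilon> n k \<omega> ^ r) \<and> expectation (\<lambda>\<omega>. \<epsilon> n k \<omega> ^ r) \<le> K" if r: "r \<le> 4" "even r" for k r
    proof -
      have int: "integrable M (\<lambda>\<omega>. \<bar>\<epsilon> n k \<omega>\<bar> ^ r)"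
        using le[OF r(1), of k] by (intro integrableI_bounded) (auto intro: le_less_trans simp: power_abs)
      moreover from int have "expectation (\<lambda>\<omega>. \<bar>\<epsilon> n k \<omega>\<bar> ^ r) \<le> K"
        using le[OF r(1), of k] K1 by (subst (asm) nn_integral_eq_integral) auto
      ultimately show ?thesis using r(2) by (simp add: power_even_abs)
    qed
    show ?thesis
      using indn mean[OF n] *[of 4] *[of 2] K1 by unfold_locales auto
  qed
  then show thesis by (rule that)
qed

lemma f_coef_eq_cross_coef:
  "f_coef d n a v w l j = cross_coef (\<lambda>j. \<Sum>\<nu>=1..d n. v \<nu> * a n j \<nu>) (\<lambda>j. \<Sum>\<nu>=1..d n. w \<nu> * a n j \<nu>) l j"
  by (simp add: f_coef_def cross_coef_def sum_product sum.distrib distrib_left mult_ac)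
     (subst sum.swap, simp)

lemma weighted_coefficient_le:
  assumes "\<And>\<nu>. \<nu> \<in> {1..m} \<Longrightarrow> \<bar>c \<nu>\<bar> \<le> C * D"
  shows "\<bar>\<Sum>\<nu>=1..m. z \<nu> * c \<nu>\<bar> \<le> (C * l1_norm m z) * D"
proof -
  have "\<bar>\<Sum>\<nu>=1..m. z \<nu> * c \<nu>\<bar> \<le> (\<Sum>\<nu>=1..m. \<bar>z \<nu>\<bar> * (C * D))"
    by (rule order_trans[OF sum_abs sum_mono]) (auto simp: abs_mult intro!: mult_left_mono assms)
  also have "\<dots> = (C * l1_norm m z) * D"
    by (simp add: l1_norm_def sum_distrib_right sum_distrib_left mult_ac)
  finally show ?thesis .
qed

text \<open>
  The constant depends on the array and on the innovations, but not on the weighting vectors: these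
  enter only through the bound of the weighted coefficients by the \<open>l1_norm\<close>.
\<close>
proposition mean_square_approximation:
  fixes \<epsilon> :: "nat \<Rightarrow> int \<Rightarrow> 'a \<Rightarrow> real"
  assumes M: "prob_space M" and \<theta>: "0 < \<theta>" "\<theta> < 1" and E: "assumption_E M \<theta> \<epsilon>" and D: "decay_D \<theta> d a"
  obtains C where "0 \<le> C"
    and "\<And>v w n m' n'. 1 \<le> n \<Longrightarrow>
       mean_sq M (\<lambda>\<omega>. part_sum M \<epsilon> d n a v w n' m' \<omega> - delta_mart M \<epsilon> d n a v w m' n' \<omega>)
       \<le> ennreal (C * ((l1_norm (d n) v)^2 * (l1_norm (d n) w)^2 * real n' powr (1 - \<theta>)))"
proof -
  obtain K where K: "\<And>n. 1 \<le> n \<Longrightarrow> indep_innovations M (\<epsilon> n) K"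
    using uniform_innovations[OF M E] by blast
  obtain C0 where C0: "\<And>j n \<nu>. 1 \<le> n \<Longrightarrow> \<nu> \<in> {1..d n} \<Longrightarrow> \<bar>a n j \<nu>\<bar> \<le> C0 * decay \<theta> j"
    using D unfolding decay_D_def decay_def by blast
  define C where "C = 8 * K^2 * energy_const \<theta> * C0 ^ 4"
  have C: "0 \<le> C" unfolding C_def energy_const_def using \<theta> by simp
  moreover have "mean_sq M (\<lambda>\<omega>. part_sum M \<epsilon> d n a v w n' m' \<omega> - delta_mart M \<epsilon> d n a v w m' n' \<omega>)
       \<le> ennreal (C * ((l1_norm (d n) v)^2 * (l1_norm (d n) w)^2 * real n' powr (1 - \<theta>)))" if n: "1 \<le> n" for v w n m' n'
  proof -
    interpret indep_innovations M "\<epsilon> n" K by (rule K[OF n])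
    define \<alpha> where "\<alpha> = (\<lambda>j. \<Sum>\<nu>=1..d n. v \<nu> * a n j \<nu>)"
    define \<beta> where "\<beta> = (\<lambda>j. \<Sum>\<nu>=1..d n. w \<nu> * a n j \<nu>)"
    define F where "F = (\<lambda>l. suminf (cross_coef \<alpha> \<beta> l))"
    have le: "\<bar>\<alpha> j\<bar> \<le> C0 * l1_norm (d n) v * decay \<theta> j" "\<bar>\<beta> j\<bar> \<le> C0 * l1_norm (d n) w * decay \<theta> j" for j
      unfolding \<alpha>_def \<beta>_def by (intro weighted_coefficient_le C0 n; assumption)+
    have lp: "lin_proc \<epsilon> d n a v i = lin \<alpha> i" "lin_proc \<epsilon> d n a w i = lin \<beta> i" for i
      by (simp_all add: fun_eq_iff lin_proc_def lin_def \<alpha>_def \<beta>_def)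
    have ft: "f_tail d n a v w l 0 = F l" for l
      by (simp add: f_tail_def F_def f_coef_eq_cross_coef \<alpha>_def \<beta>_def)
    define G where "G = (\<lambda>i \<omega>. F 0 * (\<epsilon> n (int i) \<omega> ^ 2 - \<sigma>2 (int i))
              + \<epsilon> n (int i) \<omega> * (\<Sum>l. F (Suc l) * \<epsilon> n (int i - int (Suc l)) \<omega>))"
    have mart: "mart M \<epsilon> d n a v w k \<omega> = (\<Sum>i=1..k. G i \<omega>)" for k \<omega>
      by (simp add: mart_def ft G_def var_arr_def sum.distrib sum_distrib_left)
    have dm: "delta_mart M \<epsilon> d n a v w m' n' \<omega> = (\<Sum>i=m'+1..m'+n'. G i \<omega>)" for \<omega>
      using sum.ub_add_nat[of 1 m' "\<lambda>i. G i \<omega>" n'] by (simp add: delta_mart_def mart)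
    have "mean_sq M (\<lambda>\<omega>. part_sum M \<epsilon> d n a v w n' m' \<omega> - delta_mart M \<epsilon> d n a v w m' n' \<omega>)
       \<le> ennreal (2 * K^2 * (energy_const \<theta> * (2 * (C0 * l1_norm (d n) v) * (C0 * l1_norm (d n) w))^2 * real n' powr (1 - \<theta>)))"
      using mean_square_residual[OF \<theta> le, of m' n']
      unfolding mean_sq_def part_sum_def lp dm G_def F_def by simp
    also have "2 * K^2 * (energy_const \<theta> * (2 * (C0 * l1_norm (d n) v) * (C0 * l1_norm (d n) w))^2 * real n' powr (1 - \<theta>))
        = C * ((l1_norm (d n) v)^2 * (l1_norm (d n) w)^2 * real n' powr (1 - \<theta>))"
      by (simp add: C_def power_mult_distrib power2_eq_square power4_eq_xxxx)
    finally show ?thesis .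
  qed
  ultimately show thesis by (rule that)
qed

lemma mean_sq_vector_2:
  fixes X Y :: "'a \<Rightarrow> real"
  assumes "mean_sq M X \<le> ennreal x" "mean_sq M Y \<le> ennreal y" "0 \<le> x" "0 \<le> y"
    and [measurable]: "X \<in> borel_measurable M" "Y \<in> borel_measurable M"
  shows "mean_sq M (\<lambda>\<omega>. vector [X \<omega>, Y \<omega>] :: real^2) \<le> ennreal (x + y)"
proof -
  have n: "(norm (vector [a, b] :: real^2))^2 = a^2 + b^2" for a b
    by (simp add: norm_vec_def L2_set_def UNIV_2)
  have "mean_sq M (\<lambda>\<omega>. vector [X \<omega>, Y \<omega>] :: real^2) = mean_sq M X + mean_sq M Y"
    unfolding mean_sq_def n by (subst nn_integral_add[symmetric]) auto
  also have "\<dots> \<le> ennreal x + ennreal y" by (intro add_mono assms)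
  finally show ?thesis using assms by simp
qed

lemma approximation_error_measurable:
  assumes M: "prob_space M" and E: "assumption_E M \<theta> \<epsilon>" and n: "1 \<le> n"
  shows "(\<lambda>\<omega>. part_sum M \<epsilon> d n a v w n' m' \<omega> - delta_mart M \<epsilon> d n a v w m' n' \<omega>) \<in> borel_measurable M"
proof -
  obtain K where "indep_innovations M (\<epsilon> n) K"
    using uniform_innovations[OF M E] n by blast
  then interpret indep_innovations M "\<epsilon> n" K .
  show ?thesis
    unfolding part_sum_def delta_mart_def mart_def lin_proc_def by measurable
qed

text \<open>
  The squared norm is the sum of the squares of the two components, and \<open>k powr (1 - \<theta>)\<close> is increasing
  in \<open>k\<close>.
\<close>
proposition mean_square_approximation_bivariate:
  fixes \<epsilon> :: "nat \<Rightarrow> int \<Rightarrow> 'a \<Rightarrow> real"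
  assumes M: "prob_space M" and \<theta>: "0 < \<theta>" "\<theta> < 1" and E: "assumption_E M \<theta> \<epsilon>"
    and b: "decay_D \<theta> d b" and c: "decay_D \<theta> d c"
  obtains C where
    "\<And>v w v' w' n k. k \<in> {1..n} \<Longrightarrow>
       mean_sq M (\<lambda>\<omega>. D_vec M \<epsilon> d n b v w c v' w' k \<omega> - delta_mart_vec M \<epsilon> d n b v w c v' w' k \<omega>)
       \<le> ennreal (C * (max ((l1_norm (d n) v)^2 * (l1_norm (d n) w)^2)
                             ((l1_norm (d n) v')^2 * (l1_norm (d n) w')^2) * real n powr (1 - \<theta>)))"
proof -
  obtain B where B: "0 \<le> B" and B_le: "\<And>v w n m' n'. 1 \<le> n \<Longrightarrow>
       mean_sq M (\<lambda>\<omega>. part_sum M \<epsilon> d n b v w n' m' \<omega> - delta_mart M \<epsilon> d n b v w m' n' \<omega>)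
       \<le> ennreal (B * ((l1_norm (d n) v)^2 * (l1_norm (d n) w)^2 * real n' powr (1 - \<theta>)))"
    using mean_square_approximation[OF M \<theta> E b] by blast
  obtain C where C: "0 \<le> C" and C_le: "\<And>v w n m' n'. 1 \<le> n \<Longrightarrow>
       mean_sq M (\<lambda>\<omega>. part_sum M \<epsilon> d n c v w n' m' \<omega> - delta_mart M \<epsilon> d n c v w m' n' \<omega>)
       \<le> ennreal (C * ((l1_norm (d n) v)^2 * (l1_norm (d n) w)^2 * real n' powr (1 - \<theta>)))"
    using mean_square_approximation[OF M \<theta> E c] by blast
  show thesis
  proof (rule that[of "B + C"])
    fix v w v' w' :: "nat \<Rightarrow> real" and n k :: nat
    assume k: "k \<in> {1..n}"
    then have n: "1 \<le> n" by auto
    let ?V = "(l1_norm (d n) v)^2 * (l1_norm (d n) w)^2"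
    let ?V' = "(l1_norm (d n) v')^2 * (l1_norm (d n) w')^2"
    let ?k = "real k powr (1 - \<theta>)" and ?n = "real n powr (1 - \<theta>)"
    have kn: "?k \<le> ?n" using k \<theta> by (intro powr_mono2) auto
    have eq: "D_vec M \<epsilon> d n b v w c v' w' k \<omega> - delta_mart_vec M \<epsilon> d n b v w c v' w' k \<omega> =
        vector [part_sum M \<epsilon> d n b v w k 0 \<omega> - delta_mart M \<epsilon> d n b v w 0 k \<omega>,
                part_sum M \<epsilon> d n c v' w' k 0 \<omega> - delta_mart M \<epsilon> d n c v' w' 0 k \<omega>]" for \<omega>
      by (simp add: D_vec_def delta_mart_vec_def vec_eq_iff forall_2)
    have "mean_sq M (\<lambda>\<omega>. D_vec M \<epsilon> d n b v w c v' w' k \<omega> - delta_mart_vec M \<epsilon> d n b v w c v' w' k \<omega>)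
       \<le> ennreal (B * (?V * ?k) + C * (?V' * ?k))"
      unfolding eq using B C
      by (intro mean_sq_vector_2 B_le C_le n approximation_error_measurable[OF M E n]) auto
    also have "B * (?V * ?k) + C * (?V' * ?k) \<le> B * (max ?V ?V' * ?n) + C * (max ?V ?V' * ?n)"
      using B C kn by (intro add_mono mult_left_mono mult_mono) (auto simp: le_max_iff_disj)
    also have "\<dots> = (B + C) * (max ?V ?V' * ?n)" by (simp add: distrib_right)
    finally show "mean_sq M (\<lambda>\<omega>. D_vec M \<epsilon> d n b v w c v' w' k \<omega> - delta_mart_vec M \<epsilon> d n b v w c v' w' k \<omega>)
       \<le> ennreal ((B + C) * (max ?V ?V' * ?n))" by (simp add: ennreal_leI)
  qed
qed

theorem lemma2:
  fixes M :: "'a measure"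
    and \<theta> :: real
    and d :: "nat \<Rightarrow> nat"
    and \<epsilon> :: "nat \<Rightarrow> int \<Rightarrow> 'a \<Rightarrow> real"
    and a b c :: "nat \<Rightarrow> nat \<Rightarrow> nat \<Rightarrow> real"
    and v w v' w' :: "nat \<Rightarrow> nat \<Rightarrow> real"
  assumes "prob_space M"
    and "0 < \<theta>" and "\<theta> < 1/2"
    and "assumption_E M \<theta> \<epsilon>"
    and "decay_D \<theta> d a" and "decay_D \<theta> d b" and "decay_D \<theta> d c"
  shows "(\<exists>C. \<forall>n\<ge>1. \<forall>m' n'.
           mean_sq M (\<lambda>\<omega>. part_sum M \<epsilon> d n a (v n) (w n) n' m' \<omega>
                          - delta_mart M \<epsilon> d n a (v n) (w n) m' n' \<omega>)
             \<le> ennreal (C * ((l1_norm (d n) (v n))^2 * (l1_norm (d n) (w n))^2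
                          * real n' powr (1 - \<theta>))))
       \<and> (\<exists>C. \<forall>n\<ge>1. \<forall>k\<ge>1.
           mean_sq M (\<lambda>\<omega>. part_sum M \<epsilon> d n b (v n) (w n) k 0 \<omega>
                          - delta_mart M \<epsilon> d n b (v n) (w n) 0 k \<omega>)
             \<le> ennreal (C * ((l1_norm (d n) (v n))^2 * (l1_norm (d n) (w n))^2
                          * real k powr (1 - \<theta>))))
       \<and> (\<exists>C. \<forall>n\<ge>1. \<forall>k\<ge>1.
           mean_sq M (\<lambda>\<omega>. part_sum M \<epsilon> d n c (v n) (w n) k 0 \<omega>
                          - delta_mart M \<epsilon> d n c (v n) (w n) 0 k \<omega>)
             \<le> ennreal (C * ((l1_norm (d n) (v n))^2 * (l1_norm (d n) (w n))^2
                          * real k powr (1 - \<theta>))))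
       \<and> (\<exists>C. \<forall>n\<ge>1. \<forall>k\<in>{1..n}.
           mean_sq M (\<lambda>\<omega>. D_vec M \<epsilon> d n b (v n) (w n) c (v n) (w n) k \<omega>
                          - delta_mart_vec M \<epsilon> d n b (v n) (w n) c (v n) (w n) k \<omega>)
             \<le> ennreal (C * ((l1_norm (d n) (v n))^2 * (l1_norm (d n) (w n))^2
                          * real n powr (1 - \<theta>))))
       \<and> (\<exists>C. \<forall>n\<ge>1. \<forall>k\<ge>1.
           mean_sq M (\<lambda>\<omega>. part_sum M \<epsilon> d n b (v n) (w n) k 0 \<omega>
                          - delta_mart M \<epsilon> d n b (v n) (w n) 0 k \<omega>)
             \<le> ennreal (C * ((l1_norm (d n) (v n))^2 * (l1_norm (d n) (w n))^2
                          * real k powr (1 - \<theta>))))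
       \<and> (\<exists>C. \<forall>n\<ge>1. \<forall>k\<ge>1.
           mean_sq M (\<lambda>\<omega>. part_sum M \<epsilon> d n c (v' n) (w' n) k 0 \<omega>
                          - delta_mart M \<epsilon> d n c (v' n) (w' n) 0 k \<omega>)
             \<le> ennreal (C * ((l1_norm (d n) (v' n))^2 * (l1_norm (d n) (w' n))^2
                          * real k powr (1 - \<theta>))))
       \<and> (\<exists>C. \<forall>n\<ge>1. \<forall>k\<in>{1..n}.
           mean_sq M (\<lambda>\<omega>. D_vec M \<epsilon> d n b (v n) (w n) c (v' n) (w' n) k \<omega>
                          - delta_mart_vec M \<epsilon> d n b (v n) (w n) c (v' n) (w' n) k \<omega>)
             \<le> ennreal (C * (max ((l1_norm (d n) (v n))^2 * (l1_norm (d n) (w n))^2)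
                               ((l1_norm (d n) (v' n))^2 * (l1_norm (d n) (w' n))^2)
                          * real n powr (1 - \<theta>))))"
proof -
  have \<theta>: "\<theta> < 1" using assms(3) by simp
  note approx = mean_square_approximation[OF assms(1,2) \<theta> assms(4)]
  obtain A where A: "\<And>v w n m' n'. 1 \<le> n \<Longrightarrow>
       mean_sq M (\<lambda>\<omega>. part_sum M \<epsilon> d n a v w n' m' \<omega> - delta_mart M \<epsilon> d n a v w m' n' \<omega>)
       \<le> ennreal (A * ((l1_norm (d n) v)^2 * (l1_norm (d n) w)^2 * real n' powr (1 - \<theta>)))"
    using approx[OF assms(5)] by metis
  obtain B where B: "\<And>v w n m' n'. 1 \<le> n \<Longrightarrow>
       mean_sq M (\<lambda>\<omega>. part_sum M \<epsilon> d n b v w n' m' \<omega> - delta_mart M \<epsilon> d n b v w m' n' \<omega>)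
       \<le> ennreal (B * ((l1_norm (d n) v)^2 * (l1_norm (d n) w)^2 * real n' powr (1 - \<theta>)))"
    using approx[OF assms(6)] by metis
  obtain C where C: "\<And>v w n m' n'. 1 \<le> n \<Longrightarrow>
       mean_sq M (\<lambda>\<omega>. part_sum M \<epsilon> d n c v w n' m' \<omega> - delta_mart M \<epsilon> d n c v w m' n' \<omega>)
       \<le> ennreal (C * ((l1_norm (d n) v)^2 * (l1_norm (d n) w)^2 * real n' powr (1 - \<theta>)))"
    using approx[OF assms(7)] by metis
  obtain BC where BC: "\<And>v w v' w' n k. k \<in> {1..n} \<Longrightarrow>
       mean_sq M (\<lambda>\<omega>. D_vec M \<epsilon> d n b v w c v' w' k \<omega> - delta_mart_vec M \<epsilon> d n b v w c v' w' k \<omega>)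
       \<le> ennreal (BC * (max ((l1_norm (d n) v)^2 * (l1_norm (d n) w)^2)
                             ((l1_norm (d n) v')^2 * (l1_norm (d n) w')^2) * real n powr (1 - \<theta>)))"
    using mean_square_approximation_bivariate[OF assms(1,2) \<theta> assms(4,6,7)] by blast
  show ?thesis
    apply (intro conjI)
    subgoal by (rule exI[of _ A], intro allI impI, rule A)
    subgoal by (rule exI[of _ B], intro allI impI, rule B)
    subgoal by (rule exI[of _ C], intro allI impI, rule C)
    subgoal using BC[where v = "v n" and w = "w n" and v' = "v n" and w' = "w n" and n = n for n]
      by (intro exI[of _ BC] allI impI ballI) (simp only: max.idem)
    subgoal by (rule exI[of _ B], intro allI impI, rule B)
    subgoal by (rule exI[of _ C], intro allI impI, rule C)
    subgoal by (rule exI[of _ BC], intro allI impI ballI, rule BC)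
    done
qed

end
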